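(* Let $\mu$ be a symmetric nonnegative Radon measure on $\mathbb{R}\setminus\{0\}$ with $\int(|z|^2\wedge1)\,\mathrm{d}\mu(z)<+\infty$. Then there is a nonconstant $u\in L^\infty(\mathbb{R})$ such that $\mathcal{L}^\mu[u]=0$ in $\mathcal{D}'(\mathbb{R})$ if and only if there exist $g>0$ and numbers $\omega_n\ge0$ ($n\ge1$) with $\sum_{n\ge1}\omega_n<+\infty$ such that $$\mathcal{L}^\mu[u](x)=\sum_{n\ge1}\omega_n\big(u(x+ng)+u(x-ng)-2u(x)\big)\qquad\text{for all }u\in L^\infty(\mathbb{R}),$$ where the identity is understood in $\mathcal{D}'(\mathbb{R})$, or equivalently with the right-hand side as a normally convergent series in $L^\infty(\mathbb{R})$.
   Context: A nonnegative Radon measure on $\mathbb{R}\setminus\{0\}$ is a nonnegative Borel measure on $\mathbb{R}\setminus\{0\}$ finite on compact subsets of $\mathbb{R}\setminus\{0\}$. It is symmetric if $\mu(B)=\mu(-B)$ for all Borel $B$. The symbol $\wedge$ denotes the minimum. The operator $\mathcal{L}^\mu$ is $$\mathcal{L}^\mu[\psi](x)=\mathrm{P.V.}\int_{\mathbb{R}\setminus\{0\}}\big(\psi(x+z)-\psi(x)\big)\,\mathrm{d}\mu(z)=\lim_{r\to0^+}\int_{|z|>r}\big(\psi(x+z)-\psi(x)\big)\,\mathrm{d}\mu(z),$$ well defined for $C^2$ functions $\psi$ bounded together with their derivatives up to order two. For $u\in L^\infty(\mathbb{R})$, $\mathcal{L}^\mu[u]$ is understood as the distribution $\psi\mapsto\int_{\mathbb{R}}u(x)\,\mathcal{L}^\mu[\psi](x)\,\mathrm{d}x$,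 $\psi\in C_c^\infty(\mathbb{R})$; in particular "$\mathcal{L}^\mu[u]=0$ in $\mathcal{D}'(\mathbb{R})$" means $\int_{\mathbb{R}}u\,\mathcal{L}^\mu[\psi]\,\mathrm{d}x=0$ for all $\psi\in C_c^\infty(\mathbb{R})$. "Nonconstant" means not almost everywhere equal to a constant. A series in a normed space is normally convergent if the series of the norms converges. *)

theory Defs
  imports "HOL-Analysis.Analysis" "HOL-Probability.Essential_Supremum"
begin

text \<open>
  Measures on \<open>\<real> \<setminus> {0}\<close> have the set \<open>- {0}\<close> as their space, so no value at the origin has to
  be prescribed.
\<close>

definition radon_punctured :: "real measure \<Rightarrow> bool" where
  "radon_punctured \<mu> \<longleftrightarrow>
     sets \<mu> = sets (restrict_space borel (- {0})) \<and>
     (\<forall>K. compact K \<and> K \<subseteq> - {0} \<longrightarrow> emeasure \<mu> K < \<infinity>)"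

definition symmetric_measure :: "real measure \<Rightarrow> bool" where
  "symmetric_measure \<mu> \<longleftrightarrow> (\<forall>B\<in>sets \<mu>. emeasure \<mu> B = emeasure \<mu> (uminus ` B))"

definition levy_integrable :: "real measure \<Rightarrow> bool" where
  "levy_integrable \<mu> \<longleftrightarrow> (\<integral>\<^sup>+ z. ennreal (min (\<bar>z\<bar>\<^sup>2) 1) \<partial>\<mu>) < \<infinity>"

definition levy_op :: "real measure \<Rightarrow> (real \<Rightarrow> real) \<Rightarrow> real \<Rightarrow> real" where
  "levy_op \<mu> \<psi> x =
     Lim (at_right 0) (\<lambda>r. LINT z:{z. \<bar>z\<bar> > r}|\<mu>. \<psi> (x + z) - \<psi> x)"

definition test_functions :: "(real \<Rightarrow> real) set" where
  "test_functions =
     {\<psi>. (\<forall>k x. ((deriv ^^ k) \<psi>) differentiable (at x)) \<and> compact (closure {x. \<psi> x \<noteq> 0})}"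

text \<open>
  Elements of \<open>L\<^sup>\<infinity>(\<real>)\<close> are represented by functions; the notions below depend only on the
  class of a function modulo almost everywhere equality.
\<close>

text \<open>\<open>Linfty_norm u\<close> is meaningful for \<open>u \<in> Linfty\<close> only: an infinite essential supremum gives \<open>0\<close>.\<close>

definition Linfty_norm :: "(real \<Rightarrow> real) \<Rightarrow> real" where
  "Linfty_norm u = enn2real (esssup lebesgue (\<lambda>x. ennreal \<bar>u x\<bar>))"

definition Linfty :: "(real \<Rightarrow> real) set" where
  "Linfty = {u \<in> borel_measurable lebesgue. esssup lebesgue (\<lambda>x. ennreal \<bar>u x\<bar>) < \<infinity>}"

definition nonconstant_ae :: "(real \<Rightarrow> real) \<Rightarrow> bool" where
  "nonconstant_ae u \<longleftrightarrow> \<not> (\<exists>c. AE x in lebesgue. u x = c)"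

text \<open>
  Distributions are given by their values on \<^const>\<open>test_functions\<close>. For \<open>\<psi>\<close> a test function and \<open>\<mu>\<close> a
  symmetric Radon measure integrating \<open>|z|\<^sup>2 \<and> 1\<close>, the limit in \<^const>\<open>levy_op\<close> exists at every point
  and \<open>levy_op \<mu> \<psi>\<close> is in \<open>L\<^sup>1(\<real>)\<close>, so the pairing with \<open>u \<in> L\<^sup>\<infinity>(\<real>)\<close> is a genuine integral.
\<close>

definition distr_of :: "(real \<Rightarrow> real) \<Rightarrow> (real \<Rightarrow> real) \<Rightarrow> real" where
  "distr_of v \<psi> = (LINT x|lebesgue. v x * \<psi> x)"

definition levy_distr :: "real measure \<Rightarrow> (real \<Rightarrow> real) \<Rightarrow> (real \<Rightarrow> real) \<Rightarrow> real" where
  "levy_distr \<mu> u \<psi> = (LINT x|lebesgue. u x * levy_op \<mu> \<psi> x)"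

definition diff_term :: "real \<Rightarrow> (nat \<Rightarrow> real) \<Rightarrow> (real \<Rightarrow> real) \<Rightarrow> nat \<Rightarrow> real \<Rightarrow> real" where
  "diff_term g \<omega> u n x = \<omega> n * (u (x + real n * g) + u (x - real n * g) - 2 * u x)"

text \<open>
  The identity \<open>\<L>\<^sup>\<mu>[u] = \<Sum>\<^sub>n\<^sub>\<ge>\<^sub>1 \<omega>\<^sub>n (u(\<cdot> + n g) + u(\<cdot> - n g) - 2 u)\<close>, first with a series that converges
  in the sense of distributions, then with a normally convergent series in \<open>L\<^sup>\<infinity>(\<real>)\<close> whose
  sum \<open>v\<close> is identified with a distribution. The index shift makes the series start at \<open>n = 1\<close>.
\<close>

definition levy_eq_series_distr ::
    "real measure \<Rightarrow> real \<Rightarrow> (nat \<Rightarrow> real) \<Rightarrow> (real \<Rightarrow> real) \<Rightarrow> bool" where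
  "levy_eq_series_distr \<mu> g \<omega> u \<longleftrightarrow>
     (\<forall>\<psi>\<in>test_functions.
        (\<lambda>n. distr_of (diff_term g \<omega> u (Suc n)) \<psi>) sums levy_distr \<mu> u \<psi>)"

definition levy_eq_series_Linfty ::
    "real measure \<Rightarrow> real \<Rightarrow> (nat \<Rightarrow> real) \<Rightarrow> (real \<Rightarrow> real) \<Rightarrow> bool" where
  "levy_eq_series_Linfty \<mu> g \<omega> u \<longleftrightarrow>
     (\<forall>n. diff_term g \<omega> u (Suc n) \<in> Linfty) \<and>
     summable (\<lambda>n. Linfty_norm (diff_term g \<omega> u (Suc n))) \<and>
     (\<exists>v\<in>Linfty.
        (\<lambda>N. Linfty_norm (\<lambda>x. v x - (\<Sum>n<N. diff_term g \<omega> u (Suc n) x))) \<longlonglongrightarrow> 0 \<and>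
        (\<forall>\<psi>\<in>test_functions. levy_distr \<mu> u \<psi> = distr_of v \<psi>))"

end

theory Submission
  imports Defs
begin

text \<open>
  By symmetry \<open>\<L>\<^sup>\<mu>[\<psi>](x) = \<onehalf> \<integral> (\<psi>(x + z) + \<psi>(x - z) - 2 \<psi>(x)) d\<mu>(z)\<close>, an absolutely convergent integral.
  If \<open>\<L>\<^sup>\<mu>[u] = 0\<close>, then Fubini shows that every correlation \<open>f(t) = \<integral> u(x) \<psi>(x - t) dx\<close> with a test
  function is a bounded Lipschitz function satisfying \<open>\<L>\<^sup>\<mu>[f] = 0\<close> pointwise. For \<open>z\<close> in the
  support of \<open>\<mu>\<close>, a quantitative strong maximum principle applied to the increment
  \<open>f(\<cdot> + z) - f\<close> propagates its supremum along \<open>z, 2z, 3z, \<dots>\<close>; as \<open>f\<close> is bounded the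
  supremum cannot be positive, so \<open>f\<close> is \<open>z\<close>-periodic. The common periods of all the correlations form
  a subgroup of \<open>\<real>\<close> containing the support of \<open>\<mu>\<close>. If it has arbitrarily small positive elements,
  then all correlations are constant and so is \<open>u\<close>. Otherwise it lies in some \<open>g\<int>\<close>, hence \<open>\<mu>\<close> is
  concentrated on \<open>g\<int> \<setminus> {0}\<close> and \<open>\<omega>\<^sub>n = \<mu>{n g}\<close>. Conversely \<open>cos (2 \<pi> x / g)\<close> annihilates
  every operator of the given form.
\<close>

section \<open>Test functions\<close>

text \<open>The equation for u is only distributional and a bounded measurable u has no pointwise
  values to compare, so a maximum principle cannot be applied to u itself; testing against all
  translates of one \<psi> gives a pointwise equation for a Lipschitz function. Two obstacles
  remain. First, a supremum over the line need not be attained. Instead of passing to a limit of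
  translates, the proof uses a modulus: for every \<eta> there is a \<kappa>, uniform in x, such
  that being within \<kappa> of the supremum at x forces being within \<eta> of it at x + z0.
  Finitely many such steps can be chained. Second, near-maximality of f itself along a progression
  contradicts nothing; near-maximality of its increment does, because increments telescope. The
  support of \<mu> is never formed as a set: its points are those all of whose balls, with 0
  removed, have positive mass, and Lindelof's theorem makes the other points a null set.
  Integrability rests on one bound, second differences at most C min(z^2, 1), pointwise and in L^1;
  this is exactly the function that \<mu> integrates.\<close>

definition second_diff :: "(real \<Rightarrow> real) \<Rightarrow> real \<Rightarrow> real \<Rightarrow> real" where
  "second_diff f x z = f (x + z) + f (x - z) - 2 * f x"

lemma second_diff_minus [simp]: "second_diff f x (- z) = second_diff f x z"
  by (simp add: second_diff_def)

lemma DERIV_test_function: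
  assumes "\<psi> \<in> test_functions"
  shows "((deriv ^^ k) \<psi> has_real_derivative (deriv ^^ Suc k) \<psi> x) (at x)"
  using assms DERIV_deriv_iff_real_differentiable by (fastforce simp: test_functions_def)

lemma test_function_translate:
  assumes "\<psi> \<in> test_functions"
  shows "(\<lambda>x. \<psi> (x + t)) \<in> test_functions"
proof -
  have eq: "(deriv ^^ k) (\<lambda>x. \<psi> (x + t)) = (\<lambda>x. (deriv ^^ k) \<psi> (x + t))" for k
  proof (induction k)
    case (Suc k)
    have "((\<lambda>x. (deriv ^^ k) \<psi> (x + t)) has_real_derivative (deriv ^^ Suc k) \<psi> (x + t)) (at x)" for x
      using DERIV_test_function[OF assms, of k "x + t"] by (simp only: DERIV_shift)
    then show ?case
      by (auto simp: Suc dest!: DERIV_imp_deriv)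
  qed simp
  have "(\<lambda>x. (deriv ^^ k) \<psi> (x + t)) differentiable (at x)" for k x
    using DERIV_test_function[OF assms, of k "x + t"]
    by (simp only: DERIV_shift) (auto simp: real_differentiable_def)
  moreover have "bounded {x. \<psi> (x + t) \<noteq> 0}"
  proof -
    have "{x. \<psi> (x + t) \<noteq> 0} = (\<lambda>x. - t + x) ` {x. \<psi> x \<noteq> 0}"
      by (auto simp: image_iff algebra_simps intro: exI[of _ "_ + t"])
    then show ?thesis
      using assms bounded_translation[of "{x. \<psi> x \<noteq> 0}" "- t"] by (simp add: test_functions_def)
  qed
  ultimately show ?thesis
    by (simp add: test_functions_def eq)
qed

text \<open>One constant serves all the estimates, so that later proofs carry a single
  \<open>C\<close>. The quadratic one comes from Taylor's formula at z and at -z, whose linear terms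
  cancel in the sum.\<close>

lemma test_function_bounds:
  assumes \<psi>: "\<psi> \<in> test_functions"
  obtains R C where "R > 0" "C \<ge> 0" "\<And>x. \<bar>x\<bar> > R \<Longrightarrow> \<psi> x = 0" "\<And>x. \<bar>\<psi> x\<bar> \<le> C"
    "\<And>x y. \<bar>\<psi> x - \<psi> y\<bar> \<le> C * \<bar>x - y\<bar>" "\<And>x z. \<bar>second_diff \<psi> x z\<bar> \<le> C * z\<^sup>2"
proof -
  define D where "D k = (deriv ^^ k) \<psi>" for k
  have D0: "D 0 = \<psi>"
    by (simp add: D_def)
  have D: "(D k has_real_derivative D (Suc k) x) (at x)" for k x
    using DERIV_test_function[OF \<psi>] by (simp add: D_def)
  from \<psi> have "bounded {x. \<psi> x \<noteq> 0}"
    by (simp add: test_functions_def)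
  then obtain R where R: "R > 0" "\<And>x. \<psi> x \<noteq> 0 \<Longrightarrow> \<bar>x\<bar> \<le> R"
    by (auto simp: bounded_pos)
  \<comment> \<open>Outside the support this passes from one derivative to the next: on the open set
    |x| > R the previous derivative coincides with the zero function.\<close>
  have zero: "D k x = 0" if "\<bar>x\<bar> > R" for k x
    using that
  proof (induction k arbitrary: x)
    case 0
    then show ?case
      using R(2)[of x] by (auto simp: D0)
  next
    case (Suc k)
    have "open {y::real. R < \<bar>y\<bar>}"
      by (intro open_Collect_less continuous_intros)
    then have "((\<lambda>_. 0) has_real_derivative D (Suc k) x) (at x)"
      using has_field_derivative_transform_within_open[OF D, of "{y. R < \<bar>y\<bar>}" x k "\<lambda>_. 0"] Suc
      by auto
    then show ?case
      using DERIV_unique DERIV_const by blast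
  qed
  have "\<exists>C. \<forall>x. \<bar>D k x\<bar> \<le> C" for k
  proof -
    have "continuous_on {- R..R} (D k)"
      using D by (meson DERIV_isCont continuous_at_imp_continuous_on)
    then have "bounded (D k ` {- R..R})"
      by (intro compact_imp_bounded compact_continuous_image) auto
    then obtain C where "\<forall>x\<in>{- R..R}. \<bar>D k x\<bar> \<le> C"
      by (auto simp: bounded_iff)
    then have "\<bar>D k x\<bar> \<le> C" if "\<bar>x\<bar> \<le> R" for x
      using that by (auto simp: abs_le_iff)
    then show ?thesis
      using zero by (metis abs_ge_zero abs_zero linorder_not_less order_trans R(1) less_imp_le)
  qed
  then obtain C where C: "\<And>k x. \<bar>D k x\<bar> \<le> C k"
    by metis
  have C0: "C k \<ge> 0" for k
    using C[of k 0] by linarith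
  have lip: "\<bar>\<psi> x - \<psi> y\<bar> \<le> C 1 * \<bar>x - y\<bar>" for x y
    using field_differentiable_bound[where S = UNIV and f = \<psi> and f' = "D 1" and B = "C 1" and x = x and y = y] D[of 0] C[of 1]
    by (simp add: D0)
  have taylor: "\<bar>\<psi> (x + z) - \<psi> x - D 1 x * z\<bar> \<le> C 2 / 2 * z\<^sup>2" for x z
  proof -
    have "DERIV (\<lambda>h. D m (x + h)) h :> D (Suc m) (x + h)" for m h
      using D[of m "x + h"] DERIV_shift[of "D m" "D (Suc m) (x + h)" h x] by (simp add: add.commute)
    with Maclaurin_all_le[of "\<lambda>m h. D m (x + h)" "\<lambda>h. \<psi> (x + h)" z 2]
    obtain t where "\<psi> (x + z) = (\<Sum>m<2. (D m (x + 0) / fact m) * z ^ m) + (D 2 (x + t) / fact 2) * z ^ 2"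
      unfolding D0 by blast
    then have "\<psi> (x + z) - \<psi> x - D 1 x * z = D 2 (x + t) / 2 * z\<^sup>2"
      by (simp add: numeral_2_eq_2 D0)
    moreover have "\<bar>D 2 (x + t) / 2 * z\<^sup>2\<bar> \<le> C 2 / 2 * z\<^sup>2"
      using C[of 2 "x + t"] by (simp add: abs_mult mult_right_mono)
    ultimately show ?thesis
      by (simp only:)
  qed
  have sd: "\<bar>second_diff \<psi> x z\<bar> \<le> C 2 * z\<^sup>2" for x z
    using taylor[of x z] taylor[of x "- z"] unfolding second_diff_def abs_le_iff
    by auto
  define C' where "C' = C 0 + C 1 + C 2"
  have C': "C k \<le> C'" if "k \<in> {0, 1, 2}" for k
    using that C0[of 0] C0[of 1] C0[of 2] by (auto simp: C'_def)
  show ?thesis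
  proof
    show "R > 0" "C' \<ge> 0"
      using R C'[of 0] C0[of 0] by auto
    show "\<psi> x = 0" if "\<bar>x\<bar> > R" for x
      using zero[OF that, of 0] by (simp add: D0)
    show "\<bar>\<psi> x\<bar> \<le> C'" for x
      using C[of 0 x] C'[of 0] by (simp add: D0)
    show "\<bar>\<psi> x - \<psi> y\<bar> \<le> C' * \<bar>x - y\<bar>" for x y
      using lip[of x y] C'[of 1] mult_right_mono[of "C 1" C' "\<bar>x - y\<bar>"] by auto
    show "\<bar>second_diff \<psi> x z\<bar> \<le> C' * z\<^sup>2" for x z
      using sd[of x z] C'[of 2] mult_right_mono[of "C 2" C' "z\<^sup>2"] by auto
  qed
qed

lemma continuous_test_function: "\<psi> \<in> test_functions \<Longrightarrow> continuous_on UNIV \<psi>"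
  using DERIV_test_function[of \<psi> 0]
  by (metis DERIV_isCont continuous_at_imp_continuous_on funpow_0)

lemma borel_measurable_test_function:
  "\<psi> \<in> test_functions \<Longrightarrow> \<psi> \<in> borel_measurable borel"
  by (intro borel_measurable_continuous_onI continuous_test_function)

section \<open>Smooth bumps approximating the indicator of an interval\<close>

text \<open>Raise y \<le> exp y, with y = x / k, to the power k. It lets exp (- c / q) absorb any
  negative power of q.\<close>

lemma power_le_exp:
  fixes x :: real
  assumes "x \<ge> 0" "k > 0"
  shows "x ^ k \<le> real k ^ k * exp x"
proof -
  have "(x / k) ^ k \<le> exp (x / k) ^ k"
    using assms exp_ge_add_one_self[of "x / k"] by (intro power_mono) (linarith, simp)
  also have "exp (x / k) ^ k = exp x"
    using assms by (simp flip: exp_of_nat_mult)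
  finally show ?thesis
    using assms by (simp add: power_divide field_simps)
qed

text \<open>The parameter \<open>c\<close> is kept free because, for p = 1 and m = 0, letting
  \<open>c\<close> tend to 0 yields the indicator of the open interval.\<close>

definition bump :: "real \<Rightarrow> real \<Rightarrow> real \<Rightarrow> real poly \<Rightarrow> nat \<Rightarrow> real \<Rightarrow> real" where
  "bump c a b p m x =
     (if a < x \<and> x < b then poly p x / ((x - a) * (b - x)) ^ m * exp (- c / ((x - a) * (b - x))) else 0)"

text \<open>All the derivatives of \<open>bump c a b 1 0\<close> stay in this family, and every member is bounded by
  the square of the distance to any point outside of the interval, hence differentiable there.\<close>

lemma bump_quadratic_bound:
  assumes "c > 0"
  obtains K where "\<And>x e. \<not> (a < e \<and> e < b) \<Longrightarrow> \<bar>bump c a b p m x\<bar> \<le> K * (x - e)\<^sup>2"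
proof -
  have "bounded (poly p ` {a..b})"
    by (intro compact_imp_bounded compact_continuous_image continuous_intros) auto
  then obtain M where M: "M > 0" "\<And>x. a \<le> x \<Longrightarrow> x \<le> b \<Longrightarrow> \<bar>poly p x\<bar> \<le> M"
    by (auto simp: bounded_pos)
  \<comment> \<open>This is \<open>power_le_exp\<close> at c / q with exponent m + 2: m powers of q
    pay for the denominator, and two are left for the quadratic bound.\<close>
  define L where "L = real (m + 2) ^ (m + 2) / c ^ (m + 2)"
  have "\<bar>bump c a b p m x\<bar> \<le> (M * L * (b - a)\<^sup>2) * (x - e)\<^sup>2" if e: "\<not> (a < e \<and> e < b)" for x e
  proof (cases "a < x \<and> x < b")
    case True
    define q where "q = (x - a) * (b - x)"
    have q: "q > 0"
      using True by (simp add: q_def)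
    have "M \<ge> 0"
      using M(1) by simp
    have "L \<ge> 0"
      using assms by (simp add: L_def)
    \<comment> \<open>One factor of q is the distance from x to the endpoint on the side of e, hence
      at most |x - e|; the other is at most b - a.\<close>
    have qe: "q \<le> (b - a) * \<bar>x - e\<bar>"
    proof (cases "e \<le> a")
      case True
      then show ?thesis
        using \<open>a < x \<and> x < b\<close> mult_mono[of "b - x" "b - a" "x - a" "\<bar>x - e\<bar>"]
        by (simp add: q_def mult.commute)
    next
      case False
      then show ?thesis
        using \<open>a < x \<and> x < b\<close> e mult_mono[of "x - a" "b - a" "b - x" "\<bar>x - e\<bar>"]
        by (simp add: q_def mult.commute)
    qed
    have "(c / q) ^ (m + 2) \<le> real (m + 2) ^ (m + 2) * exp (c / q)"
      using assms q by (intro power_le_exp) auto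
    then have "1 / q ^ m * exp (- c / q) \<le> L * q\<^sup>2"
      using assms q
      by (simp add: L_def exp_minus field_simps power_divide power_add power2_eq_square)
    then have "M * (1 / q ^ m * exp (- c / q)) \<le> M * (L * q\<^sup>2)"
      using \<open>M \<ge> 0\<close> by (rule mult_left_mono)
    moreover have "\<bar>bump c a b p m x\<bar> \<le> M * (1 / q ^ m * exp (- c / q))"
    proof -
      have "\<bar>bump c a b p m x\<bar> = \<bar>poly p x\<bar> * (1 / q ^ m * exp (- c / q))"
        using True q by (simp add: bump_def abs_mult flip: q_def)
      also have "\<dots> \<le> M * (1 / q ^ m * exp (- c / q))"
        using M(2)[of x] True q by (intro mult_right_mono) auto
      finally show ?thesis .
    qed
    moreover have "M * (L * q\<^sup>2) \<le> M * (L * ((b - a) * \<bar>x - e\<bar>)\<^sup>2)"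
      using qe q \<open>M \<ge> 0\<close> \<open>L \<ge> 0\<close> by (intro mult_left_mono power_mono) auto
    ultimately show ?thesis
      by (simp add: power_mult_distrib mult.assoc)
  next
    case False
    have "0 \<le> M * L * (b - a)\<^sup>2 * (x - e)\<^sup>2"
      using M(1) assms by (auto simp: L_def intro!: mult_nonneg_nonneg)
    moreover have "bump c a b p m x = 0"
      using False by (auto simp: bump_def)
    ultimately show ?thesis
      by simp
  qed
  then show ?thesis
    by (rule that)
qed

lemma DERIV_bump:
  assumes "c > 0"
  obtains p' where "\<And>x. (bump c a b p m has_real_derivative bump c a b p' (m + 2) x) (at x)"
proof
  define q where "q = [:- a, 1:] * [:b, - 1:]"
  have q: "poly q x = (x - a) * (b - x)" for x
    by (simp add: q_def algebra_simps)
  \<comment> \<open>Numerator of the derivative over the common denominator q^(m+2); the exponential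
    contributes the last summand.\<close>
  let ?p' = "pderiv p * q\<^sup>2 - of_nat m * p * pderiv q * q + smult c (p * pderiv q)"
  fix x
  show "(bump c a b p m has_real_derivative bump c a b ?p' (m + 2) x) (at x)"
  proof (cases "a < x \<and> x < b")
    case True
    have bump_eq: "bump c a b r k x = poly r x / poly q x ^ k * exp (- c / poly q x)" for r k
      using True by (simp add: bump_def q)
    have q0: "poly q x > 0"
      using True by (simp add: q)
    have "((\<lambda>x. poly p x * inverse (poly q x ^ m) * exp (- c / poly q x)) has_real_derivative
         ((poly (pderiv p) x * inverse (poly q x ^ m)
           - poly p x * (of_nat m * poly (pderiv q) x * poly q x ^ (m - 1)) * inverse (poly q x ^ m * poly q x ^ m))
           * exp (- c / poly q x)
         + poly p x * inverse (poly q x ^ m) * (exp (- c / poly q x) * (c * poly (pderiv q) x / (poly q x)\<^sup>2)))) (at x)"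
      using q0 
      by (auto intro!: derivative_eq_intros simp: field_simps power2_eq_square)
    also have "((poly (pderiv p) x * inverse (poly q x ^ m)
           - poly p x * (of_nat m * poly (pderiv q) x * poly q x ^ (m - 1)) * inverse (poly q x ^ m * poly q x ^ m))
           * exp (- c / poly q x)
         + poly p x * inverse (poly q x ^ m) * (exp (- c / poly q x) * (c * poly (pderiv q) x / (poly q x)\<^sup>2)))
         = bump c a b ?p' (m + 2) x"
      using q0 by (cases m) (auto simp: bump_eq field_simps power2_eq_square)
    finally show ?thesis
      by (rule has_field_derivative_transform_within_open[where S = "{a<..<b}"])
        (use True in \<open>auto simp: bump_def q divide_inverse\<close>)
  next
    case False
    \<comment> \<open>Here x itself lies outside the open interval, possibly at an endpoint, so e =
      x is allowed and the difference quotient is at most K |y - x|.\<close>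
    obtain K where K: "\<And>x e. \<not> (a < e \<and> e < b) \<Longrightarrow> \<bar>bump c a b p m x\<bar> \<le> K * (x - e)\<^sup>2"
      using bump_quadratic_bound[OF assms] by metis
    have x0: "bump c a b p' m' x = 0" for p' m'
      using False by (auto simp: bump_def)
    have "((\<lambda>y. (bump c a b p m y - bump c a b p m x) / (y - x)) \<longlongrightarrow> 0) (at x)"
    proof (rule Lim_null_comparison)
      have "\<bar>bump c a b p m y / (y - x)\<bar> \<le> K * \<bar>y - x\<bar>" if "y \<noteq> x" for y
        using K[OF False, of y] that by (simp add: field_simps power2_eq_square flip: abs_mult)
      then show "\<forall>\<^sub>F y in at x. norm ((bump c a b p m y - bump c a b p m x) / (y - x)) \<le> K * \<bar>y - x\<bar>"
        by (simp add: x0 eventually_at_filter)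
      have "((\<lambda>y. K * \<bar>y - x\<bar>) \<longlongrightarrow> K * \<bar>x - x\<bar>) (at x)"
        by (intro tendsto_intros)
      then show "((\<lambda>y. K * \<bar>y - x\<bar>) \<longlongrightarrow> 0) (at x)"
        by simp
    qed
    then show ?thesis
      by (simp add: has_field_derivative_iff x0)
  qed
qed

lemma bump_in_test_functions:
  assumes "c > 0"
  shows "bump c a b p m \<in> test_functions"
proof -
  have "\<exists>p' m'. (deriv ^^ k) (bump c a b p m) = bump c a b p' m'" for k
  proof (induction k)
    case (Suc k)
    then obtain p' m' where IH: "(deriv ^^ k) (bump c a b p m) = bump c a b p' m'"
      by blast
    obtain p'' where "\<And>x. (bump c a b p' m' has_real_derivative bump c a b p'' (m' + 2) x) (at x)"
      using DERIV_bump[OF assms] by metis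
    then have "(deriv ^^ Suc k) (bump c a b p m) = bump c a b p'' (m' + 2)"
      by (auto simp: IH dest!: DERIV_imp_deriv)
    then show ?case
      by blast
  qed auto
  moreover have "bump c a b p' m' differentiable (at x)" for p' m' x
    using DERIV_bump[OF assms, of a b p' m'] real_differentiable_def by metis
  moreover have "bounded {x. bump c a b p m x \<noteq> 0}"
    by (rule bounded_subset[of "{a..b}"]) (auto simp: bump_def)
  ultimately show ?thesis
    by (auto simp: test_functions_def) metis
qed

lemma bump_tendsto_indicator:
  "(\<lambda>n. bump (1 / Suc n) a b 1 0 x) \<longlonglongrightarrow> indicator {a<..<b} x"
proof (cases "a < x \<and> x < b")
  case True
  have "(\<lambda>n. exp (- (1 / Suc n) / ((x - a) * (b - x)))) \<longlonglongrightarrow> exp (- 0 / ((x - a) * (b - x)))"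
    by (intro tendsto_intros LIMSEQ_Suc lim_1_over_n) (use True in auto)
  then show ?thesis
    using True by (simp add: bump_def)
qed (auto simp: bump_def indicator_def)

lemma abs_bump_le_indicator:
  assumes "c > 0"
  shows "\<bar>bump c a b 1 0 x\<bar> \<le> indicator {a<..<b} x"
  using assms by (auto simp: bump_def indicator_def)

section \<open>Bounded functions and their pairings with test functions\<close>

lemma AE_lborel_translate:
  fixes P :: "real \<Rightarrow> bool"
  assumes "AE x in lborel. P x"
  shows "AE x in lborel. P (x + c)"
proof -
  obtain N where N: "{x \<in> space lborel. \<not> P x} \<subseteq> N" "N \<in> null_sets lborel"
    using assms by (auto elim!: AE_E simp: null_sets_def)
  then have [measurable]: "N \<in> sets borel"
    by auto
  have "AE x in lborel. c + 1 * x \<notin> N"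
    using N by (intro AE_borel_affine[of 1 "\<lambda>x. x \<notin> N"]) (auto intro: AE_not_in)
  then show ?thesis
    by eventually_elim (use N in \<open>auto simp: add.commute\<close>)
qed

lemma lborel_integral_translate: "(\<integral>x. f (x + c) \<partial>lborel) = (\<integral>x. (f x :: real) \<partial>lborel)" for c :: real
  using lborel_integral_real_affine[of 1 f c] by (simp add: add.commute)

lemma lborel_integrable_translate_iff:
  "integrable lborel (\<lambda>x. f (x + c) :: real) \<longleftrightarrow> integrable lborel f" for c :: real
  using lborel_integrable_real_affine_iff[of 1 f c] by (simp add: add.commute)

text \<open>A signed function is not a density, so K is added first. Cut off to (-n, n), w + K and K
  define finite measures with equal mass on every half-line; the measures agree, and uniqueness of
  densities gives w = 0 almost everywhere there.\<close>

lemma AE_eq_0_if_interval_integrals_eq_0: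
  fixes w :: "real \<Rightarrow> real"
  assumes [measurable]: "w \<in> borel_measurable borel" and K: "\<And>x. \<bar>w x\<bar> \<le> K"
    and zero: "\<And>a b. (\<integral>x. w x * indicator {a<..<b} x \<partial>lborel) = 0"
  shows "AE x in lborel. w x = 0"
proof -
  have "AE x in lborel. x \<in> {- real n<..<real n} \<longrightarrow> w x = 0" for n
  proof -
    let ?I = "{- real n<..<real n}"
    have K0: "w x + K \<ge> 0" "K \<ge> 0" for x
      using K[of x] by auto
    have int: "integrable lborel (\<lambda>x. c * indicator {a<..<b} x)" for a b c :: real
      by (cases "a < b") auto
    have intw: "integrable lborel (\<lambda>x. (w x + c) * indicator {a<..<b} x)" for a b c :: real
      by (rule integrableI_bounded_set[where A = "{a<..<b}" and B = "K + \<bar>c\<bar>"])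
        (use K in \<open>auto simp: emeasure_bounded_finite[unfolded infinity_ennreal_def] indicator_def
          intro!: order_trans[OF abs_triangle_ineq] add_mono\<close>)
    have int': "integrable lborel (\<lambda>x. w x * indicator {a<..<b} x)" for a b :: real
      using intw[of 0] by simp
    let ?M = "density lborel (\<lambda>x. ennreal ((w x + K) * indicator ?I x))"
    let ?N = "density lborel (\<lambda>x. ennreal (K * indicator ?I x))"
    have em: "emeasure (density lborel (\<lambda>x. ennreal (f x * indicator ?I x))) {y<..}
        = ennreal (\<integral>x. f x * indicator {max (- real n) y<..<real n} x \<partial>lborel)"
      if [measurable]: "f \<in> borel_measurable borel" and f: "\<And>x. f x \<ge> 0"
        and int: "\<And>a b. integrable lborel (\<lambda>x. f x * indicator {a<..<b} x)" for f y
    proof -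
      have "emeasure (density lborel (\<lambda>x. ennreal (f x * indicator ?I x))) {y<..}
          = (\<integral>\<^sup>+x. ennreal (f x * indicator ?I x) * indicator {y<..} x \<partial>lborel)"
        by (rule emeasure_density) auto
      also have "\<dots> = (\<integral>\<^sup>+x. ennreal (f x * indicator {max (- real n) y<..<real n} x) \<partial>lborel)"
        by (intro nn_integral_cong) (auto simp: indicator_def)
      also have "\<dots> = ennreal (\<integral>x. f x * indicator {max (- real n) y<..<real n} x \<partial>lborel)"
        using f by (intro nn_integral_eq_integral int) auto
      finally show ?thesis .
    qed
    have N: "emeasure ?N {y<..} = ennreal (\<integral>x. K * indicator {max (- real n) y<..<real n} x \<partial>lborel)" for y
      using int K0 by (intro em) auto
    have M: "emeasure ?M {y<..} = ennreal (\<integral>x. (w x + K) * indicator {max (- real n) y<..<real n} x \<partial>lborel)" for y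
      using intw K0 by (intro em) auto
    have "?M = ?N"
    proof (rule measure_eqI_lessThan)
      show "emeasure ?M {y<..} < \<infinity>" for y
        by (simp add: M)
      show "emeasure ?M {y<..} = emeasure ?N {y<..}" for y
        unfolding M N using zero int int' by (simp add: distrib_right)
    qed auto
    then have "AE x in lborel. ennreal ((w x + K) * indicator ?I x) = ennreal (K * indicator ?I x)"
      by (intro sigma_finite_measure.density_unique[OF sigma_finite_lborel]) auto
    then show ?thesis
      by eventually_elim (use K0 in \<open>auto simp: indicator_def\<close>)
  qed
  then have "AE x in lborel. \<forall>n. x \<in> {- real n<..<real n} \<longrightarrow> w x = 0"
    by (simp only: AE_all_countable) blast
  then show ?thesis
  proof eventually_elim
    fix x assume *: "\<forall>n. x \<in> {- real n<..<real n} \<longrightarrow> w x = 0"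
    obtain n where "\<bar>x\<bar> < real n"
      using reals_Archimedean2 by blast
    then show "w x = 0"
      using * by (auto simp: abs_less_iff)
  qed
qed

text \<open>The bumps converge to the indicator of an interval and are dominated by it, so the
  integrals over intervals vanish as well.\<close>

lemma AE_eq_0_if_test_integrals_eq_0:
  fixes w :: "real \<Rightarrow> real"
  assumes w[measurable]: "w \<in> borel_measurable borel" and K: "\<And>x. \<bar>w x\<bar> \<le> K"
    and zero: "\<And>\<psi>. \<psi> \<in> test_functions \<Longrightarrow> (\<integral>x. w x * \<psi> x \<partial>lborel) = 0"
  shows "AE x in lborel. w x = 0"
proof (rule AE_eq_0_if_interval_integrals_eq_0[OF w K])
  fix a b :: real
  let ?\<psi> = "\<lambda>n. bump (1 / Suc n) a b 1 0"
  have \<psi>: "?\<psi> n \<in> test_functions" for n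
    by (intro bump_in_test_functions) auto
  have [measurable]: "?\<psi> n \<in> borel_measurable borel" for n
    by (intro borel_measurable_test_function \<psi>)
  have "(\<lambda>n. \<integral>x. w x * ?\<psi> n x \<partial>lborel) \<longlonglongrightarrow> (\<integral>x. w x * indicator {a<..<b} x \<partial>lborel)"
  proof (rule integral_dominated_convergence)
    show "integrable lborel (\<lambda>x. K * indicator {a<..<b} x)"
      by (cases "a < b") auto
    show "AE x in lborel. (\<lambda>n. w x * ?\<psi> n x) \<longlonglongrightarrow> w x * indicator {a<..<b} x"
      by (intro AE_I2 tendsto_intros bump_tendsto_indicator)
    show "AE x in lborel. norm (w x * ?\<psi> n x) \<le> K * indicator {a<..<b} x" for n
      using K abs_bump_le_indicator[of "1 / Suc n" a b]
      by (auto simp: abs_mult intro!: AE_I2 mult_mono order_trans[OF abs_ge_zero K])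
  qed (auto simp del: of_nat_Suc)
  then show "(\<integral>x. w x * indicator {a<..<b} x \<partial>lborel) = 0"
    using zero[OF \<psi>] by (simp add: LIMSEQ_const_iff)
qed

section \<open>Essential bounds, Borel representatives and L^1 estimates\<close>

lemma AE_le_esssup_real:
  assumes "esssup M (\<lambda>x. ennreal \<bar>f x\<bar>) < \<infinity>"
  shows "AE x in M. \<bar>f x\<bar> \<le> enn2real (esssup M (\<lambda>x. ennreal \<bar>f x\<bar>))"
  using esssup_AE[of "\<lambda>x. ennreal \<bar>f x\<bar>" M]
proof eventually_elim
  fix x assume "ennreal \<bar>f x\<bar> \<le> esssup M (\<lambda>x. ennreal \<bar>f x\<bar>)"
  then show "\<bar>f x\<bar> \<le> enn2real (esssup M (\<lambda>x. ennreal \<bar>f x\<bar>))"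
    using enn2real_mono[of "ennreal \<bar>f x\<bar>" "esssup M (\<lambda>x. ennreal \<bar>f x\<bar>)"] assms by simp
qed

lemma Linfty_iff:
  "f \<in> Linfty \<longleftrightarrow> f \<in> borel_measurable lebesgue \<and> (\<exists>K. 0 \<le> K \<and> (AE x in lebesgue. \<bar>f x\<bar> \<le> K))"
proof (cases "f \<in> borel_measurable lebesgue")
  case True
  then have meas: "(\<lambda>x. ennreal \<bar>f x\<bar>) \<in> borel_measurable lebesgue"
    by measurable
  have "esssup lebesgue (\<lambda>x. ennreal \<bar>f x\<bar>) < \<infinity>" if "AE x in lebesgue. \<bar>f x\<bar> \<le> K" for K
  proof -
    have "esssup lebesgue (\<lambda>x. ennreal \<bar>f x\<bar>) \<le> ennreal K"
      using that by (intro esssup_I meas) (auto intro: ennreal_leI)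
    then show ?thesis
      using ennreal_less_top[of K] by (simp only: infinity_ennreal_def order_le_less_trans)
  qed
  then have fin: "(\<exists>K. 0 \<le> K \<and> (AE x in lebesgue. \<bar>f x\<bar> \<le> K)) \<Longrightarrow> f \<in> Linfty"
    using True by (auto simp: Linfty_def)
  have "\<exists>K. 0 \<le> K \<and> (AE x in lebesgue. \<bar>f x\<bar> \<le> K)" if "f \<in> Linfty"
    using AE_le_esssup_real[of lebesgue f] that
    by (intro exI[of _ "enn2real (esssup lebesgue (\<lambda>x. ennreal \<bar>f x\<bar>))"]) (auto simp: Linfty_def)
  with fin True show ?thesis
    by metis
qed (simp add: Linfty_def)

lemma AE_le_Linfty_norm:
  assumes "f \<in> Linfty"
  shows "AE x in lebesgue. \<bar>f x\<bar> \<le> Linfty_norm f"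
  using assms AE_le_esssup_real[of lebesgue f] by (simp add: Linfty_def Linfty_norm_def)

lemma Linfty_norm_le:
  assumes "f \<in> borel_measurable lebesgue" "0 \<le> K" "AE x in lebesgue. \<bar>f x\<bar> \<le> K"
  shows "Linfty_norm f \<le> K"
proof -
  have "esssup lebesgue (\<lambda>x. ennreal \<bar>f x\<bar>) \<le> ennreal K"
    using assms by (intro esssup_I) (auto intro: ennreal_leI)
  then show ?thesis
    using assms enn2real_leI by (auto simp: Linfty_norm_def)
qed

lemma Linfty_norm_nonneg: "0 \<le> Linfty_norm f"
  by (simp add: Linfty_norm_def)

text \<open>Fubini and the translation arguments need joint Borel measurability and a bound at every
  point, whereas \<open>Linfty\<close> offers Lebesgue measurability and an almost everywhere
  bound.\<close>

lemma Linfty_borel_representative: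
  assumes "u \<in> Linfty"
  obtains u' K where "u' \<in> borel_measurable borel" "0 \<le> K" "\<And>x. \<bar>u' x\<bar> \<le> K" "AE x in lborel. u x = u' x"
proof -
  from assms obtain K where K: "0 \<le> K" "AE x in lebesgue. \<bar>u x\<bar> \<le> K"
    and u: "u \<in> borel_measurable (completion lborel)"
    by (auto simp: Linfty_iff)
  from completion_ex_borel_measurable_real[OF u] obtain g
    where g[measurable]: "g \<in> borel_measurable borel" and eq: "AE x in lborel. u x = g x"
    by auto
  \<comment> \<open>Clamping to [-K, K] makes the bound hold everywhere and changes the function
    only on a null set.\<close>
  let ?u = "\<lambda>x. max (- K) (min K (g x))"
  have "AE x in lborel. u x = ?u x"
    using eq K(2)[unfolded AE_completion_iff] by eventually_elim auto
  then show ?thesis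
    using K(1) by (intro that[of ?u K]) auto
qed

lemma integrable_test_function:
  assumes \<psi>: "\<psi> \<in> test_functions"
  shows "integrable lborel \<psi>"
proof -
  obtain R C where "\<And>x. \<bar>x\<bar> > R \<Longrightarrow> \<psi> x = 0" "\<And>x. \<bar>\<psi> x\<bar> \<le> C"
    using test_function_bounds[OF \<psi>] by metis
  then show ?thesis
    using borel_measurable_test_function[OF \<psi>]
    by (intro integrableI_bounded_set[where A = "{- R..R}" and B = C])
      (auto simp: emeasure_bounded_finite[unfolded infinity_ennreal_def] intro!: AE_I2)
qed

lemma integrable_bounded_mult:
  fixes u :: "real \<Rightarrow> real"
  assumes [measurable]: "u \<in> borel_measurable borel" and K: "\<And>x. \<bar>u x\<bar> \<le> K" and f: "integrable lborel f"
  shows "integrable lborel (\<lambda>x. u x * f x)" "\<bar>\<integral>x. u x * f x \<partial>lborel\<bar> \<le> K * (\<integral>x. \<bar>f x\<bar> \<partial>lborel)"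
proof -
  have [measurable]: "f \<in> borel_measurable borel"
    using f by auto
  have le: "\<bar>u x * f x\<bar> \<le> K * \<bar>f x\<bar>" for x
    using K[of x] by (simp add: abs_mult mult_right_mono)
  have K': "integrable lborel (\<lambda>x. K * \<bar>f x\<bar>)"
    using f by auto
  show 1: "integrable lborel (\<lambda>x. u x * f x)"
    by (rule Bochner_Integration.integrable_bound[OF K']) (auto intro!: AE_I2 order_trans[OF le])
  show "\<bar>\<integral>x. u x * f x \<partial>lborel\<bar> \<le> K * (\<integral>x. \<bar>f x\<bar> \<partial>lborel)"
    using Bochner_Integration.integral_abs_bound_integral[OF 1 K' le] by simp
qed

lemma integrable_second_diff:
  assumes \<psi>: "\<psi> \<in> test_functions"
  shows "integrable lborel (\<lambda>x. second_diff \<psi> x z)"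
  using lborel_integrable_translate_iff[of \<psi> z] lborel_integrable_translate_iff[of \<psi> "- z"]
    integrable_test_function[OF \<psi>] by (simp add: second_diff_def)

lemma second_diff_test_bounds:
  assumes \<psi>: "\<psi> \<in> test_functions"
  obtains C where "C \<ge> 0" "\<And>x z. \<bar>second_diff \<psi> x z\<bar> \<le> C * min (z\<^sup>2) 1"
    "\<And>z. (\<integral>x. \<bar>second_diff \<psi> x z\<bar> \<partial>lborel) \<le> C * min (z\<^sup>2) 1"
    "\<And>h. \<bar>h\<bar> \<le> 1 \<Longrightarrow> (\<integral>x. \<bar>\<psi> (x + h) - \<psi> x\<bar> \<partial>lborel) \<le> C * \<bar>h\<bar>"
proof -
  obtain R C where R: "R > 0" and C: "C \<ge> 0" and supp: "\<And>x. \<bar>x\<bar> > R \<Longrightarrow> \<psi> x = 0"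
    and bnd: "\<And>x. \<bar>\<psi> x\<bar> \<le> C" and lip: "\<And>x y. \<bar>\<psi> x - \<psi> y\<bar> \<le> C * \<bar>x - y\<bar>"
    and sd: "\<And>x z. \<bar>second_diff \<psi> x z\<bar> \<le> C * z\<^sup>2"
    using test_function_bounds[OF \<psi>] by metis
  have int: "integrable lborel (\<lambda>x. \<psi> (x + h))" for h
    by (simp add: lborel_integrable_translate_iff integrable_test_function[OF \<psi>])
  define I where "I = (\<integral>x. \<bar>\<psi> x\<bar> \<partial>lborel)"
  have I: "(\<integral>x. \<bar>\<psi> (x + h)\<bar> \<partial>lborel) = I" for h
    unfolding I_def by (rule lborel_integral_translate)
  have I0: "I \<ge> 0"
    by (simp add: I_def)
  \<comment> \<open>Differences with steps of size at most 1 vanish outside [-R - 1, R + 1], an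
    interval of length 2 R + 2, so pointwise bounds become L^1 bounds.\<close>
  have loc: "(\<integral>x. \<bar>f x\<bar> \<partial>lborel) \<le> d * (2 * R + 2)"
    if f: "integrable lborel f" "\<And>x. \<bar>x\<bar> > R + 1 \<Longrightarrow> f x = 0" "\<And>x. \<bar>f x\<bar> \<le> d" for f :: "real \<Rightarrow> real" and d
  proof -
    have "(\<integral>x. \<bar>f x\<bar> \<partial>lborel) \<le> (\<integral>x. d * indicator {- (R + 1)..R + 1} x \<partial>lborel)"
    proof (rule integral_mono)
      show "integrable lborel (\<lambda>x. d * indicator {- (R + 1)..R + 1} x)"
        using R by auto
      show "\<bar>f x\<bar> \<le> d * indicator {- (R + 1)..R + 1} x" for x
        using f(2)[of x] f(3)[of x] by (auto simp: indicator_def)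
    qed (use f in auto)
    also have "\<dots> = d * (2 * R + 2)"
      using R by simp
    finally show ?thesis .
  qed
  \<comment> \<open>The summands cover, in this order, the pointwise bound for large z, integration
    over the enlarged support, and the L^1 norms of the four translates in a second difference with
    large z.\<close>
  define C' where "C' = 4 * C + C * (2 * R + 2) + 4 * I"
  have CR: "C * (2 * R + 2) \<ge> 0"
    using C R by simp
  have C': "C' \<ge> 4 * C" "C' \<ge> C * (2 * R + 2)" "C' \<ge> 4 * I" "C' \<ge> C" "C' \<ge> 0"
    unfolding C'_def using C R I0 CR by linarith+
  show ?thesis
  proof
    show "C' \<ge> 0"
      by fact
    show "\<bar>second_diff \<psi> x z\<bar> \<le> C' * min (z\<^sup>2) 1" for x z
    proof (cases "z\<^sup>2 \<le> 1")
      case True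
      then show ?thesis
        using sd[of x z] mult_right_mono[OF C'(4), of "z\<^sup>2"] by simp
    next
      case False
      then show ?thesis
        using bnd[of x] bnd[of "x + z"] bnd[of "x - z"] C' by (simp add: second_diff_def)
    qed
    show "(\<integral>x. \<bar>second_diff \<psi> x z\<bar> \<partial>lborel) \<le> C' * min (z\<^sup>2) 1" for z
    proof (cases "\<bar>z\<bar> \<le> 1")
      case True
      have "(\<integral>x. \<bar>second_diff \<psi> x z\<bar> \<partial>lborel) \<le> (C * z\<^sup>2) * (2 * R + 2)"
        using integrable_second_diff[OF \<psi>] sd True
        by (intro loc) (auto simp: second_diff_def supp)
      also have "\<dots> \<le> C' * z\<^sup>2"
        using mult_right_mono[OF C'(2), of "z\<^sup>2"] by (simp add: mult_ac)
      finally show ?thesis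
        using True by (simp add: abs_square_le_1)
    next
      case False
      have "(\<integral>x. \<bar>second_diff \<psi> x z\<bar> \<partial>lborel)
          \<le> (\<integral>x. \<bar>\<psi> (x + z)\<bar> + \<bar>\<psi> (x + - z)\<bar> + 2 * \<bar>\<psi> (x + 0)\<bar> \<partial>lborel)"
        using integrable_second_diff[OF \<psi>] int[of z] int[of "- z"] int[of 0]
        by (intro integral_mono integrable_abs Bochner_Integration.integrable_add
            integrable_mult_right) (auto simp: second_diff_def)
      also have "\<dots> = 4 * I"
        using int[of z] int[of "- z"] int[of 0] I[of z] I[of "- z"] I[of 0] by simp
      finally show ?thesis
        using False C' by (simp add: abs_square_le_1 min_def)
    qed
    show "(\<integral>x. \<bar>\<psi> (x + h) - \<psi> x\<bar> \<partial>lborel) \<le> C' * \<bar>h\<bar>" if "\<bar>h\<bar> \<le> 1" for h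
    proof -
      have "(\<integral>x. \<bar>\<psi> (x + h) - \<psi> x\<bar> \<partial>lborel) \<le> (C * \<bar>h\<bar>) * (2 * R + 2)"
      proof (rule loc)
        show "\<bar>\<psi> (x + h) - \<psi> x\<bar> \<le> C * \<bar>h\<bar>" for x
          using lip[of "x + h" x] by simp
      qed (use int[of h] int[of 0] that in \<open>auto simp: supp\<close>)
      also have "\<dots> \<le> C' * \<bar>h\<bar>"
        using mult_right_mono[OF C'(2), of "\<bar>h\<bar>"] by (simp add: mult_ac)
      finally show ?thesis .
    qed
  qed
qed

section \<open>The operator as an integral of second differences\<close>

locale symmetric_levy_measure =
  fixes \<mu> :: "real measure"
  assumes radon: "radon_punctured \<mu>"
    and symmetric: "symmetric_measure \<mu>"
    and levy: "levy_integrable \<mu>"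
begin

lemma sets_mu: "sets \<mu> = sets (restrict_space borel (- {0}))"
  using radon by (simp add: radon_punctured_def)

lemma space_mu: "space \<mu> = - {0}"
  using sets_eq_imp_space_eq[OF sets_mu] by (simp add: space_restrict_space)

lemma in_sets_mu_iff: "B \<in> sets \<mu> \<longleftrightarrow> B \<in> sets borel \<and> 0 \<notin> B"
  by (subst sets_mu, subst sets_restrict_space_iff) auto

lemma measurable_mu: "f \<in> measurable borel N \<Longrightarrow> f \<in> measurable \<mu> N"
  using measurable_restrict_space1 measurable_cong_sets[OF sets_mu refl] by blast

text \<open>The sigma-algebra of \<mu> is a trace on the punctured line; this carries joint Borel
  measurability over to the product used in Fubini's theorem.\<close>

lemma measurable_lborel_mu:
  assumes "case_prod f \<in> measurable (borel \<Otimes>\<^sub>M borel) N"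
  shows "case_prod f \<in> measurable (lborel \<Otimes>\<^sub>M \<mu>) N"
proof -
  have "fst \<in> measurable (lborel \<Otimes>\<^sub>M \<mu>) borel" "snd \<in> measurable (lborel \<Otimes>\<^sub>M \<mu>) borel"
    using measurable_compose[OF measurable_snd measurable_mu[OF measurable_ident]]
      measurable_compose[OF measurable_fst, of "\<lambda>x. x" lborel borel] by auto
  then have "(\<lambda>p. (fst p, snd p)) \<in> measurable (lborel \<Otimes>\<^sub>M \<mu>) (borel \<Otimes>\<^sub>M borel)"
    by (rule measurable_Pair)
  from measurable_compose[OF this assms] show ?thesis
    by (simp add: case_prod_beta')
qed

lemma integrable_min: "integrable \<mu> (\<lambda>z. min (z\<^sup>2) 1)"
proof (rule integrableI_nonneg)
  show "(\<lambda>z. min (z\<^sup>2) 1) \<in> borel_measurable \<mu>"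
    by (rule measurable_mu) auto
  show "(\<integral>\<^sup>+ z. ennreal (min (z\<^sup>2) 1) \<partial>\<mu>) < \<infinity>"
    using levy by (simp add: levy_integrable_def)
qed auto

text \<open>Chebyshev's inequality for min(z^2, 1). The Radon condition speaks of compact sets only;
  these sets are unbounded.\<close>

lemma emeasure_away_from_0:
  assumes "r > 0"
  shows "emeasure \<mu> {z. \<bar>z\<bar> > r} < \<infinity>"
proof -
  have S: "{z. \<bar>z\<bar> > r} \<in> sets \<mu>"
    using assms by (simp add: in_sets_mu_iff)
  define m where "m = min (r\<^sup>2) 1"
  have m: "m > 0"
    using assms by (simp add: m_def)
  have "ennreal m * emeasure \<mu> {z. \<bar>z\<bar> > r} = (\<integral>\<^sup>+ z. ennreal m * indicator {z. \<bar>z\<bar> > r} z \<partial>\<mu>)"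
    using S by (simp add: nn_integral_cmult_indicator)
  also have "\<dots> \<le> (\<integral>\<^sup>+ z. ennreal (min (\<bar>z\<bar>\<^sup>2) 1) \<partial>\<mu>)"
  proof (rule nn_integral_mono)
    fix z
    have "r\<^sup>2 \<le> z\<^sup>2" if "\<bar>z\<bar> > r"
      using that assms power_mono[of r "\<bar>z\<bar>" 2] by simp
    then show "ennreal m * indicator {z. \<bar>z\<bar> > r} z \<le> ennreal (min (\<bar>z\<bar>\<^sup>2) 1)"
      by (auto simp: indicator_def m_def intro!: ennreal_leI)
  qed
  also have "\<dots> < \<infinity>"
    using levy by (simp add: levy_integrable_def)
  finally show ?thesis
    using m by (auto simp: ennreal_mult_less_top)
qed

sublocale sigma_finite_measure \<mu>
proof
  show "\<exists>A. countable A \<and> A \<subseteq> sets \<mu> \<and> \<Union> A = space \<mu> \<and> (\<forall>a\<in>A. emeasure \<mu> a \<noteq> \<infinity>)"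
  proof (intro exI[of _ "range (\<lambda>n. {z. \<bar>z\<bar> > 1 / real (Suc n)})"] conjI ballI)
    show "\<Union> (range (\<lambda>n. {z. \<bar>z\<bar> > 1 / real (Suc n)})) = space \<mu>"
    proof -
      have "\<exists>n. 1 / real (Suc n) < \<bar>z\<bar>" if "z \<noteq> 0" for z
        using nat_approx_posE[of "\<bar>z\<bar>"] that by (metis zero_less_abs_iff)
      then show ?thesis
        by (auto simp: space_mu simp del: of_nat_Suc)
    qed
    show "emeasure \<mu> a \<noteq> \<infinity>" if "a \<in> range (\<lambda>n. {z. \<bar>z\<bar> > 1 / real (Suc n)})" for a
      using that emeasure_away_from_0 by (auto simp: less_top)
  qed (auto simp: in_sets_mu_iff)
qed

lemma measurable_uminus_mu: "uminus \<in> measurable \<mu> \<mu>"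
proof -
  have "uminus \<in> measurable \<mu> (restrict_space borel (- {0}))"
    by (rule measurable_restrict_space2) (auto simp: space_mu intro!: measurable_mu)
  then show ?thesis
    using measurable_cong_sets[OF refl sets_mu] by blast
qed

lemma distr_uminus: "distr \<mu> \<mu> uminus = \<mu>"
proof (rule measure_eqI)
  fix A assume "A \<in> sets (distr \<mu> \<mu> uminus)"
  then have A: "A \<in> sets \<mu>"
    by simp
  have "uminus -` A \<inter> space \<mu> = uminus ` A"
    using A by (auto simp: space_mu in_sets_mu_iff image_iff) (metis minus_minus)
  then show "emeasure (distr \<mu> \<mu> uminus) A = emeasure \<mu> A"
    using symmetric A measurable_uminus_mu by (simp add: emeasure_distr symmetric_measure_def)
qed simp

lemma integral_uminus:
  fixes f :: "real \<Rightarrow> real"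
  assumes "f \<in> borel_measurable borel"
  shows "(\<integral>z. f (- z) \<partial>\<mu>) = (\<integral>z. f z \<partial>\<mu>)"
  using integral_distr[OF measurable_uminus_mu, of f] measurable_mu[OF assms] by (simp add: distr_uminus)

lemma integrable_second_diff_mu:
  assumes [measurable]: "f \<in> borel_measurable borel"
    and C: "\<And>z. \<bar>second_diff f x z\<bar> \<le> C * min (z\<^sup>2) 1"
  shows "integrable \<mu> (second_diff f x)"
proof (rule Bochner_Integration.integrable_bound)
  show "integrable \<mu> (\<lambda>z. C * min (z\<^sup>2) 1)"
    using integrable_min by auto
  show "second_diff f x \<in> borel_measurable \<mu>"
    unfolding second_diff_def [abs_def] by (intro measurable_mu) measurable
  show "AE z in \<mu>. norm (second_diff f x z) \<le> norm (C * min (z\<^sup>2) 1)"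
    by (intro AE_I2) (metis C abs_ge_self order_trans real_norm_def)
qed

text \<open>Average the integrand over z and -z. The truncation makes the two first-difference
  integrals finite separately, so that the sum may be split.\<close>

lemma truncated_levy_integral:
  assumes \<psi>: "\<psi> \<in> test_functions" and r: "r > 0"
  shows "(LINT z:{z. \<bar>z\<bar> > r}|\<mu>. \<psi> (x + z) - \<psi> x)
    = 1 / 2 * (\<integral>z. indicator {z. \<bar>z\<bar> > r} z * second_diff \<psi> x z \<partial>\<mu>)"
proof -
  obtain C where C: "\<And>x. \<bar>\<psi> x\<bar> \<le> C"
    using test_function_bounds[OF \<psi>] by metis
  note [measurable] = borel_measurable_test_function[OF \<psi>]
  let ?S = "{z. \<bar>z\<bar> > r}"
  have S: "?S \<in> sets \<mu>"
    using r by (simp add: in_sets_mu_iff)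
  have bnd: "\<bar>\<psi> y - \<psi> x\<bar> \<le> 2 * C" for y
    using C[of y] C[of x] by linarith
  have "integrable \<mu> (\<lambda>z. indicator ?S z *\<^sub>R (\<psi> (f z) - \<psi> x))"
    if "f \<in> borel_measurable borel" for f
    using integrableI_bounded_set_indicator[OF S _ emeasure_away_from_0[OF r], of "\<lambda>z. \<psi> (f z) - \<psi> x" "2 * C"]
      measurable_mu[OF that, THEN measurable_compose, OF borel_measurable_test_function[OF \<psi>]] bnd by simp
  from this[of "\<lambda>z. x + z"] this[of "\<lambda>z. x - z"]
  have 1: "integrable \<mu> (\<lambda>z. indicator ?S z * (\<psi> (x + z) - \<psi> x))"
    and 2: "integrable \<mu> (\<lambda>z. indicator ?S z * (\<psi> (x - z) - \<psi> x))"
    by auto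
  have "(\<integral>z. indicator ?S (- z) * (\<psi> (x + - z) - \<psi> x) \<partial>\<mu>) = (\<integral>z. indicator ?S z * (\<psi> (x + z) - \<psi> x) \<partial>\<mu>)"
    by (rule integral_uminus) auto
  then have eq: "(\<integral>z. indicator ?S z * (\<psi> (x - z) - \<psi> x) \<partial>\<mu>) = (\<integral>z. indicator ?S z * (\<psi> (x + z) - \<psi> x) \<partial>\<mu>)"
    by (simp add: indicator_def)
  have "(\<integral>z. indicator ?S z * second_diff \<psi> x z \<partial>\<mu>)
      = (\<integral>z. indicator ?S z * (\<psi> (x + z) - \<psi> x) + indicator ?S z * (\<psi> (x - z) - \<psi> x) \<partial>\<mu>)"
    by (intro Bochner_Integration.integral_cong) (auto simp: second_diff_def indicator_def)
  also have "\<dots> = 2 * (\<integral>z. indicator ?S z * (\<psi> (x + z) - \<psi> x) \<partial>\<mu>)"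
    using 1 2 eq by simp
  finally show ?thesis
    by (simp add: set_lebesgue_integral_def)
qed

text \<open>First differences are of order |z| near 0, which \<mu> need not integrate. After
  symmetrization the second difference is an integrable majorant for all truncations, and dominated
  convergence applies.\<close>

lemma levy_op_eq:
  assumes \<psi>: "\<psi> \<in> test_functions"
  shows "levy_op \<mu> \<psi> x = 1 / 2 * (\<integral>z. second_diff \<psi> x z \<partial>\<mu>)"
proof -
  have int: "integrable \<mu> (second_diff \<psi> x)"
    using second_diff_test_bounds[OF \<psi>] integrable_second_diff_mu[OF borel_measurable_test_function[OF \<psi>]]
    by metis
  have "((\<lambda>r. \<integral>z. indicator {z. \<bar>z\<bar> > r} z * second_diff \<psi> x z \<partial>\<mu>) \<longlongrightarrow> (\<integral>z. second_diff \<psi> x z \<partial>\<mu>)) (at_right 0)"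
  proof (rule tendsto_at_right_sequentially[of 0 1])
    fix S :: "nat \<Rightarrow> real" assume S: "\<And>n. 0 < S n" "S \<longlonglongrightarrow> 0"
    show "(\<lambda>n. \<integral>z. indicator {z. \<bar>z\<bar> > S n} z * second_diff \<psi> x z \<partial>\<mu>) \<longlonglongrightarrow> (\<integral>z. second_diff \<psi> x z \<partial>\<mu>)"
    proof (rule integral_dominated_convergence)
      show "integrable \<mu> (\<lambda>z. \<bar>second_diff \<psi> x z\<bar>)"
        using int by auto
      show "AE z in \<mu>. (\<lambda>n. indicator {z. \<bar>z\<bar> > S n} z * second_diff \<psi> x z) \<longlonglongrightarrow> second_diff \<psi> x z"
      proof (rule AE_I2)
        fix z assume "z \<in> space \<mu>"
        then have "\<forall>\<^sub>F n in sequentially. S n < \<bar>z\<bar>"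
          using order_tendstoD(2)[OF S(2), of "\<bar>z\<bar>"] by (simp add: space_mu)
        then have "\<forall>\<^sub>F n in sequentially. indicator {z. \<bar>z\<bar> > S n} z * second_diff \<psi> x z = second_diff \<psi> x z"
          by eventually_elim (auto simp: indicator_def)
        then show "(\<lambda>n. indicator {z. \<bar>z\<bar> > S n} z * second_diff \<psi> x z) \<longlonglongrightarrow> second_diff \<psi> x z"
          by (rule tendsto_eventually)
      qed
      show "(\<lambda>z. indicator {z. \<bar>z\<bar> > S n} z * second_diff \<psi> x z) \<in> borel_measurable \<mu>" for n
        using int S(1)[of n]
        by (intro borel_measurable_times borel_measurable_indicator) (auto simp: in_sets_mu_iff)
    qed (use int in \<open>auto simp: indicator_def\<close>)
  qed auto
  then have "((\<lambda>r. 1 / 2 * (\<integral>z. indicator {z. \<bar>z\<bar> > r} z * second_diff \<psi> x z \<partial>\<mu>))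
      \<longlongrightarrow> 1 / 2 * (\<integral>z. second_diff \<psi> x z \<partial>\<mu>)) (at_right 0)"
    by (intro tendsto_intros)
  moreover have "\<forall>\<^sub>F r in at_right 0. 1 / 2 * (\<integral>z. indicator {z. \<bar>z\<bar> > r} z * second_diff \<psi> x z \<partial>\<mu>)
      = (LINT z:{z. \<bar>z\<bar> > r}|\<mu>. \<psi> (x + z) - \<psi> x)"
    using eventually_at_right_less[of 0] by eventually_elim (simp add: truncated_levy_integral[OF \<psi>])
  ultimately have "((\<lambda>r. LINT z:{z. \<bar>z\<bar> > r}|\<mu>. \<psi> (x + z) - \<psi> x)
      \<longlongrightarrow> 1 / 2 * (\<integral>z. second_diff \<psi> x z \<partial>\<mu>)) (at_right 0)"
    by (rule Lim_transform_eventually)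
  then show ?thesis
    unfolding levy_op_def by (intro tendsto_Lim) auto
qed

lemma borel_measurable_second_diff_pair:
  assumes "\<psi> \<in> test_functions"
  shows "(\<lambda>(x, z). second_diff \<psi> x z) \<in> borel_measurable (borel \<Otimes>\<^sub>M borel)"
  using borel_measurable_test_function[OF assms] unfolding second_diff_def by measurable

lemma borel_measurable_levy_op:
  assumes \<psi>: "\<psi> \<in> test_functions"
  shows "levy_op \<mu> \<psi> \<in> borel_measurable borel"
proof -
  have "(\<lambda>(x, z). second_diff \<psi> x z) \<in> borel_measurable (lborel \<Otimes>\<^sub>M \<mu>)"
    by (intro measurable_lborel_mu borel_measurable_second_diff_pair \<psi>)
  then have "(\<lambda>x. \<integral>z. second_diff \<psi> x z \<partial>\<mu>) \<in> borel_measurable lborel"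
    by (rule borel_measurable_lebesgue_integral)
  moreover have "levy_op \<mu> \<psi> = (\<lambda>x. 1 / 2 * (\<integral>z. second_diff \<psi> x z \<partial>\<mu>))"
    by (simp add: levy_op_eq[OF \<psi>] fun_eq_iff)
  ultimately show ?thesis
    by simp
qed

text \<open>Integrating in x first leaves a function of z alone. For translates of one \<psi> it is
  a second difference of a correlation, and for multiples of g it is the pairing of a series term;
  both directions of the argument meet in this formula.\<close>

lemma levy_distr_eq:
  assumes u: "u \<in> Linfty"
    and v[measurable]: "v \<in> borel_measurable borel" and K: "\<And>x. \<bar>v x\<bar> \<le> K"
    and uv: "AE x in lborel. u x = v x"
    and \<psi>: "\<psi> \<in> test_functions"
  shows "levy_distr \<mu> u \<psi> = 1 / 2 * (\<integral>z. (\<integral>x. v x * second_diff \<psi> x z \<partial>lborel) \<partial>\<mu>)"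
proof -
  interpret P: pair_sigma_finite \<mu> lborel ..
  obtain C where C: "C \<ge> 0" "\<And>z. (\<integral>x. \<bar>second_diff \<psi> x z\<bar> \<partial>lborel) \<le> C * min (z\<^sup>2) 1"
    using second_diff_test_bounds[OF \<psi>] by metis
  note [measurable] = borel_measurable_levy_op[OF \<psi>] borel_measurable_second_diff_pair[OF \<psi>]
  have f: "(\<lambda>(x, z). v x * second_diff \<psi> x z) \<in> borel_measurable (lborel \<Otimes>\<^sub>M \<mu>)"
    by (rule measurable_lborel_mu) measurable
  have f': "(\<lambda>(z, x). v x * second_diff \<psi> x z) \<in> borel_measurable (\<mu> \<Otimes>\<^sub>M lborel)"
    using measurable_compose[OF measurable_pair_swap' f] by (simp add: case_prod_beta')
  have intx: "integrable lborel (\<lambda>x. v x * second_diff \<psi> x z)" for z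
    by (rule integrable_bounded_mult[OF v K integrable_second_diff[OF \<psi>]])
  \<comment> \<open>Tonelli's test: after taking absolute values and integrating in x, K C min(z^2,
    1) is a \<mu>-integrable majorant.\<close>
  have int: "integrable (\<mu> \<Otimes>\<^sub>M lborel) (\<lambda>(z, x). v x * second_diff \<psi> x z)"
  proof (rule P.Fubini_integrable[OF f'])
    have "(\<integral>x. norm (v x * second_diff \<psi> x z) \<partial>lborel) \<le> K * C * min (z\<^sup>2) 1" for z
    proof -
      have "(\<integral>x. norm (v x * second_diff \<psi> x z) \<partial>lborel) \<le> (\<integral>x. K * \<bar>second_diff \<psi> x z\<bar> \<partial>lborel)"
        using integrable_norm[OF intx] integrable_abs[OF integrable_second_diff[OF \<psi>]] K
        by (intro integral_mono) (auto simp: abs_mult intro!: mult_right_mono)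
      also have "\<dots> \<le> K * (C * min (z\<^sup>2) 1)"
        using C(2)[of z] order_trans[OF abs_ge_zero K[of 0]] by (simp add: mult_left_mono)
      finally show ?thesis
        by (simp add: mult.assoc)
    qed
    then have le: "norm (\<integral>x. norm (v x * second_diff \<psi> x z) \<partial>lborel) \<le> norm (K * C * min (z\<^sup>2) 1)" for z
      unfolding real_norm_def by (intro order_trans[OF eq_refl[OF abs_of_nonneg] order_trans[OF _ abs_ge_self]]) auto
    have meas: "(\<lambda>z. \<integral>x. norm (v x * second_diff \<psi> x z) \<partial>lborel) \<in> borel_measurable \<mu>"
      using measurable_compose[OF f' borel_measurable_norm]
      by (intro sigma_finite_measure.borel_measurable_lebesgue_integral[OF sigma_finite_lborel]) (simp add: case_prod_beta')
    have "integrable \<mu> (\<lambda>z. K * C * min (z\<^sup>2) 1)"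
      using integrable_min by auto
    then show "integrable \<mu> (\<lambda>z. \<integral>x. norm (case (z, x) of (z, x) \<Rightarrow> v x * second_diff \<psi> x z) \<partial>lborel)"
      by (rule Bochner_Integration.integrable_bound)
        (use meas le in auto)
  qed (use intx in auto)
  have "levy_distr \<mu> u \<psi> = (\<integral>x. v x * levy_op \<mu> \<psi> x \<partial>lebesgue)"
    unfolding levy_distr_def
  proof (rule integral_cong_AE)
    show "AE x in lebesgue. u x * levy_op \<mu> \<psi> x = v x * levy_op \<mu> \<psi> x"
      using AE_completion[OF uv] by eventually_elim simp
    have "levy_op \<mu> \<psi> \<in> borel_measurable lebesgue"
      by (intro measurable_completion) simp
    then show "(\<lambda>x. u x * levy_op \<mu> \<psi> x) \<in> borel_measurable lebesgue"
      using u by (intro borel_measurable_times) (auto simp: Linfty_iff)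
    show "(\<lambda>x. v x * levy_op \<mu> \<psi> x) \<in> borel_measurable lebesgue"
      by (intro measurable_completion) simp
  qed
  also have "\<dots> = (\<integral>x. v x * levy_op \<mu> \<psi> x \<partial>lborel)"
    by (rule integral_completion) simp
  also have "\<dots> = 1 / 2 * (\<integral>x. (\<integral>z. v x * second_diff \<psi> x z \<partial>\<mu>) \<partial>lborel)"
    by (simp add: levy_op_eq[OF \<psi>] mult.assoc[symmetric] flip: integral_mult_right_zero)
  also have "(\<integral>x. (\<integral>z. v x * second_diff \<psi> x z \<partial>\<mu>) \<partial>lborel) = (\<integral>z. (\<integral>x. v x * second_diff \<psi> x z \<partial>lborel) \<partial>\<mu>)"
    by (rule P.Fubini_integral[OF int])
  finally show ?thesis .
qed

end

section \<open>The Liouville property\<close>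

text \<open>The convolution of \<open>v\<close> with the reflection of \<psi>, written as a pairing
  with a translate of \<psi> so that the distributional equation can be applied directly.\<close>

definition correlation :: "(real \<Rightarrow> real) \<Rightarrow> (real \<Rightarrow> real) \<Rightarrow> real \<Rightarrow> real" where
  "correlation v \<psi> t = (\<integral>x. v x * \<psi> (x - t) \<partial>lborel)"

lemma test_function_translate': "\<psi> \<in> test_functions \<Longrightarrow> (\<lambda>x. \<psi> (x - t)) \<in> test_functions"
  using test_function_translate[of \<psi> "- t"] by simp

lemma correlation_second_diff:
  assumes v[measurable]: "v \<in> borel_measurable borel" and K: "\<And>x. \<bar>v x\<bar> \<le> K"
    and \<psi>: "\<psi> \<in> test_functions"
  shows "second_diff (correlation v \<psi>) t z = (\<integral>x. v x * second_diff (\<lambda>x. \<psi> (x - t)) x z \<partial>lborel)"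
proof -
  have int: "integrable lborel (\<lambda>x. v x * \<psi> (x - s))" for s
    by (intro integrable_bounded_mult[OF v K] integrable_test_function test_function_translate' \<psi>)
  have "(\<integral>x. v x * second_diff (\<lambda>x. \<psi> (x - t)) x z \<partial>lborel)
      = (\<integral>x. v x * \<psi> (x - (t - z)) + v x * \<psi> (x - (t + z)) - 2 * (v x * \<psi> (x - t)) \<partial>lborel)"
    by (intro Bochner_Integration.integral_cong) (auto simp: second_diff_def algebra_simps)
  also have "\<dots> = second_diff (correlation v \<psi>) t z"
    using int by (simp add: second_diff_def correlation_def)
  finally show ?thesis ..
qed

text \<open>As \<open>v\<close> is merely bounded, all regularity is taken from \<psi>: each
  estimate is K times the L^1 norm of the corresponding difference of \<psi>.\<close>

lemma correlation_bounds:
  assumes v[measurable]: "v \<in> borel_measurable borel" and K: "\<And>x. \<bar>v x\<bar> \<le> K"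
    and \<psi>: "\<psi> \<in> test_functions"
  obtains C where "\<And>t. \<bar>correlation v \<psi> t\<bar> \<le> C"
    "\<And>t h. \<bar>h\<bar> \<le> 1 \<Longrightarrow> \<bar>correlation v \<psi> (t + h) - correlation v \<psi> t\<bar> \<le> C * \<bar>h\<bar>"
    "\<And>t z. \<bar>second_diff (correlation v \<psi>) t z\<bar> \<le> C * min (z\<^sup>2) 1"
proof -
  obtain C where C: "C \<ge> 0" "\<And>z. (\<integral>x. \<bar>second_diff \<psi> x z\<bar> \<partial>lborel) \<le> C * min (z\<^sup>2) 1"
    "\<And>h. \<bar>h\<bar> \<le> 1 \<Longrightarrow> (\<integral>x. \<bar>\<psi> (x + h) - \<psi> x\<bar> \<partial>lborel) \<le> C * \<bar>h\<bar>"
    using second_diff_test_bounds[OF \<psi>] by metis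
  have K0: "K \<ge> 0"
    using order_trans[OF abs_ge_zero K] .
  have int: "integrable lborel (\<lambda>x. \<psi> (x - s))" for s
    by (intro integrable_test_function test_function_translate' \<psi>)
  have int': "integrable lborel (\<lambda>x. v x * \<psi> (x - s))" for s
    by (intro integrable_bounded_mult[OF v K] int)
  define I where "I = (\<integral>x. \<bar>\<psi> x\<bar> \<partial>lborel)"
  define C' where "C' = K * I + K * C"
  have C': "K * I \<le> C'" "K * C \<le> C'"
    using K0 C(1) by (auto simp: C'_def I_def)
  show ?thesis
  proof
    show "\<bar>correlation v \<psi> t\<bar> \<le> C'" for t
      using integrable_bounded_mult(2)[OF v K int, of t] C'(1)
        lborel_integral_translate[of "\<lambda>x. \<bar>\<psi> x\<bar>" "- t"]
      by (simp add: correlation_def I_def)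
    show "\<bar>correlation v \<psi> (t + h) - correlation v \<psi> t\<bar> \<le> C' * \<bar>h\<bar>" if h: "\<bar>h\<bar> \<le> 1" for t h
    proof -
      have "correlation v \<psi> (t + h) - correlation v \<psi> t = (\<integral>x. v x * (\<psi> (x - (t + h)) - \<psi> (x - t)) \<partial>lborel)"
        using int' by (simp add: correlation_def right_diff_distrib)
      also have "\<bar>\<dots>\<bar> \<le> K * (\<integral>x. \<bar>\<psi> (x - (t + h)) - \<psi> (x - t)\<bar> \<partial>lborel)"
        using int by (intro integrable_bounded_mult[OF v K]) auto
      also have "(\<integral>x. \<bar>\<psi> (x - (t + h)) - \<psi> (x - t)\<bar> \<partial>lborel) = (\<integral>x. \<bar>\<psi> (x + - h) - \<psi> x\<bar> \<partial>lborel)"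
        using lborel_integral_translate[of "\<lambda>x. \<bar>\<psi> (x + - h) - \<psi> x\<bar>" "- t"]
        by (simp add: algebra_simps)
      also have "K * \<dots> \<le> K * (C * \<bar>h\<bar>)"
        using C(3)[of "- h"] h K0 by (intro mult_left_mono) auto
      also have "\<dots> \<le> C' * \<bar>h\<bar>"
        using mult_right_mono[OF C'(2), of "\<bar>h\<bar>"] by (simp add: mult.assoc)
      finally show ?thesis .
    qed
    show "\<bar>second_diff (correlation v \<psi>) t z\<bar> \<le> C' * min (z\<^sup>2) 1" for t z
    proof -
      have "\<bar>second_diff (correlation v \<psi>) t z\<bar> \<le> K * (\<integral>x. \<bar>second_diff (\<lambda>x. \<psi> (x - t)) x z\<bar> \<partial>lborel)"
        unfolding correlation_second_diff[OF v K \<psi>]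
        by (intro integrable_bounded_mult[OF v K] integrable_second_diff test_function_translate' \<psi>)
      also have "(\<integral>x. \<bar>second_diff (\<lambda>x. \<psi> (x - t)) x z\<bar> \<partial>lborel) = (\<integral>x. \<bar>second_diff \<psi> x z\<bar> \<partial>lborel)"
        using lborel_integral_translate[of "\<lambda>x. \<bar>second_diff \<psi> x z\<bar>" "- t"]
        by (simp add: second_diff_def algebra_simps)
      also have "K * \<dots> \<le> K * (C * min (z\<^sup>2) 1)"
        using C(2) K0 by (intro mult_left_mono)
      also have "\<dots> \<le> C' * min (z\<^sup>2) 1"
        using mult_right_mono[OF C'(2), of "min (z\<^sup>2) 1"] by (simp add: mult.assoc)
      finally show ?thesis .
    qed
  qed
qed

text \<open>Constant correlations make \<open>v\<close> invariant under each translation up to a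
  null set. That set depends on the translation, so Fubini is used to find one base point x with v
  (x + t) = v x for almost every t.\<close>

lemma AE_const_if_correlations_const:
  assumes v[measurable]: "v \<in> borel_measurable borel" and K: "\<And>x. \<bar>v x\<bar> \<le> K"
    and const: "\<And>\<psi> s t. \<psi> \<in> test_functions \<Longrightarrow> correlation v \<psi> s = correlation v \<psi> t"
  obtains c where "AE x in lborel. v x = c"
proof -
  have "AE x in lborel. v (x + t) - v x = 0" for t
  proof (rule AE_eq_0_if_test_integrals_eq_0)
    show "\<bar>v (x + t) - v x\<bar> \<le> 2 * K" for x
      using K[of x] K[of "x + t"] by linarith
    fix \<psi> assume \<psi>: "\<psi> \<in> test_functions"
    have int: "integrable lborel (\<lambda>x. v x * \<psi> (x - s))" for s
      by (intro integrable_bounded_mult[OF v K] integrable_test_function test_function_translate' \<psi>)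
    have eq: "(\<integral>x. v (x + t) * \<psi> x \<partial>lborel) = (\<integral>x. v x * \<psi> (x - t) \<partial>lborel)"
      using lborel_integral_translate[of "\<lambda>x. v x * \<psi> (x - t)" t] by simp
    have int_t: "integrable lborel (\<lambda>x. v (x + t) * \<psi> x)"
      using lborel_integrable_translate_iff[of "\<lambda>x. v x * \<psi> (x - t)" t] int[of t] by simp
    show "(\<integral>x. (v (x + t) - v x) * \<psi> x \<partial>lborel) = 0"
      using const[OF \<psi>, of t 0] int[of 0] int_t eq by (simp add: correlation_def left_diff_distrib)
  qed simp
  then have "AE t in lborel. AE x in lborel. v (x + t) = v x"
    by simp
  moreover have "{p \<in> space (lborel \<Otimes>\<^sub>M lborel). v (snd p + fst p) = v (snd p)} \<in> sets (lborel \<Otimes>\<^sub>M lborel)"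
    by measurable
  ultimately have "AE x in lborel. AE t in lborel. v (x + t) = v x"
    by (subst (asm) lborel_pair.AE_commute)
  \<comment> \<open>Lebesgue measure is not zero, so a property of almost every x holds for some
    x.\<close>
  moreover have "ae_filter (lborel :: real measure) \<noteq> bot"
    by (simp add: ae_filter_eq_bot_iff)
  ultimately obtain x where x: "AE t in lborel. v (x + t) = v x"
    using eventually_happens' by blast
  have "AE t in lborel. v t = v x"
    using AE_lborel_translate[OF x, of "- x"] by simp
  then show ?thesis
    by (rule that)
qed

section \<open>Small periods and discrete subgroups of the line\<close>

lemma constant_if_small_periods:
  fixes f :: "real \<Rightarrow> real"
  assumes lip: "\<And>t h. \<bar>h\<bar> \<le> 1 \<Longrightarrow> \<bar>f (t + h) - f t\<bar> \<le> C * \<bar>h\<bar>"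
    and per: "\<And>e. e > 0 \<Longrightarrow> \<exists>p. 0 < p \<and> p < e \<and> (\<forall>t. f (t + p) = f t)"
  shows "f s = f t"
proof -
  have C: "C \<ge> 0"
    using lip[of 1 0] by simp
  have "\<bar>f s - f t\<bar> \<le> 0 + e" if e: "e > 0" for e
  proof -
    \<comment> \<open>p < 1 keeps the remainder in the range of the Lipschitz bound; dividing by C +
      1 instead of C covers C = 0.\<close>
    obtain p where p: "0 < p" "p < min 1 (e / (C + 1))" "\<And>t. f (t + p) = f t"
      using per[of "min 1 (e / (C + 1))"] e C by auto
    have nat: "f (t + real n * p) = f t" for n t
    proof (induction n)
      case (Suc n)
      then show ?case
        using p(3)[of "t + real n * p"] by (simp add: algebra_simps)
    qed simp
    have int: "f (t + of_int k * p) = f t" for k t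
    proof (cases "k \<ge> 0")
      case True
      then show ?thesis
        using nat[of t "nat k"] by simp
    next
      case False
      then show ?thesis
        using nat[of "t + of_int k * p" "nat (- k)"] by simp
    qed
    define k where "k = \<lfloor>(s - t) / p\<rfloor>"
    define h where "h = (s - t) - of_int k * p"
    have "of_int k * p \<le> s - t" "s - t < (of_int k + 1) * p"
      using p(1) by (simp_all add: k_def floor_divide_lower floor_divide_upper)
    then have h: "0 \<le> h" "h < p"
      by (auto simp: h_def algebra_simps)
    have "f s - f t = f ((t + of_int k * p) + h) - f (t + of_int k * p)"
      by (simp add: int h_def)
    also have "\<bar>\<dots>\<bar> \<le> C * \<bar>h\<bar>"
      using h p by (intro lip) auto
    also have "\<dots> \<le> (C + 1) * (e / (C + 1))"
      using h p C by (intro mult_mono) auto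
    finally show ?thesis
      using C by simp
  qed
  then have "\<bar>f s - f t\<bar> \<le> 0"
    by (rule field_le_epsilon)
  then show ?thesis
    by simp
qed

lemma discrete_additive_subgroup:
  fixes P :: "real set"
  assumes "0 \<in> P" and diff: "\<And>p q. p \<in> P \<Longrightarrow> q \<in> P \<Longrightarrow> p - q \<in> P"
    and e: "e > 0" "\<And>p. p \<in> P \<Longrightarrow> 0 < p \<Longrightarrow> e \<le> p"
  obtains g where "g > 0" "P \<subseteq> range (\<lambda>k::int. of_int k * g)"
proof (cases "\<exists>p\<in>P. p > 0")
  case False
  \<comment> \<open>Without positive elements P is {0}, and any g would do. In the application this
    occurs only for \<mu> = 0.\<close>
  have "P \<subseteq> range (\<lambda>k::int. of_int k * 1)"
  proof
    fix p assume "p \<in> P"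
    then have "\<not> 0 < p" "\<not> 0 < 0 - p"
      using False diff[OF \<open>0 \<in> P\<close>] by blast+
    then have "p = 0"
      by simp
    then show "p \<in> range (\<lambda>k::int. of_int k * 1)"
      by (intro image_eqI[of _ _ 0]) auto
  qed
  then show ?thesis
    using that[of 1] by simp
next
  case True
  define Q where "Q = {p \<in> P. p > 0}"
  define g where "g = Inf Q"
  have Q: "Q \<noteq> {}" "bdd_below Q"
    using True e by (auto simp: Q_def intro!: bdd_belowI[of _ 0])
  have g: "g \<ge> e"
    unfolding g_def using Q e by (intro cInf_greatest) (auto simp: Q_def)
  have lower: "g \<le> p" if "p \<in> P" "p > 0" for p
    unfolding g_def using that Q by (intro cInf_lower) (auto simp: Q_def)
  obtain p where p: "p \<in> Q" "p < g + e"
    using cInf_lessD[OF Q(1), of "g + e"] e by (auto simp: g_def)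
  \<comment> \<open>The gap \<open>e\<close> makes the infimum attained: otherwise some q in Q
    satisfies g \<le> q < p < g + e, and p - q is a positive element below \<open>e\<close>.\<close>
  have "p = g"
  proof (rule ccontr)
    assume "p \<noteq> g"
    then have "g < p"
      using lower p by (force simp: Q_def)
    then obtain q where q: "q \<in> Q" "q < p"
      using cInf_lessD[OF Q(1), of p] by (auto simp: g_def)
    then have "e \<le> p - q"
      using p diff e(2)[of "p - q"] by (auto simp: Q_def)
    then show False
      using p(2) lower[of q] q by (auto simp: Q_def)
  qed
  then have "g \<in> P"
    using p by (simp add: Q_def)
  have g0: "g > 0"
    using g e by simp
  have uminus: "- p \<in> P" if "p \<in> P" for p
    using diff[OF \<open>0 \<in> P\<close> that] by simp
  have nat: "real n * g \<in> P" for n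
  proof (induction n)
    case (Suc n)
    then show ?case
      using diff[OF Suc uminus[OF \<open>g \<in> P\<close>]] by (simp add: algebra_simps)
  qed (simp add: \<open>0 \<in> P\<close>)
  have int: "of_int k * g \<in> P" for k
    using nat[of "nat k"] uminus[OF nat[of "nat (- k)"]] by (cases "k \<ge> 0") auto
  have "P \<subseteq> range (\<lambda>k::int. of_int k * g)"
  proof
    fix p assume p: "p \<in> P"
    define k where "k = \<lfloor>p / g\<rfloor>"
    have k: "of_int k * g \<le> p" "p < (of_int k + 1) * g"
      using g0 by (simp_all add: k_def floor_divide_lower floor_divide_upper)
    have "p - of_int k * g \<in> P"
      by (intro diff p int)
    then have "p - of_int k * g = 0"
      using lower[of "p - of_int k * g"] k by (force simp: algebra_simps)
    then show "p \<in> range (\<lambda>k::int. of_int k * g)"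
      by auto
  qed
  then show ?thesis
    using that g0 by blast
qed

section \<open>Strong maximum principle and periodicity along the support\<close>

context symmetric_levy_measure
begin

text \<open>If \<open>v x > M - \<kappa>\<close>, then \<open>second_diff v x \<le> 2 \<kappa>\<close> everywhere, and it is below \<open>2 \<kappa> - \<eta> / 2\<close> near \<open>z0\<close>
  if \<open>v (x + z0) \<le> M - \<eta>\<close>; since its integral vanishes, this is impossible for small \<open>\<kappa>\<close>.\<close>

lemma max_principle_step:
  fixes v :: "real \<Rightarrow> real"
  assumes [measurable]: "v \<in> borel_measurable borel"
    and lip: "\<And>x h. \<bar>h\<bar> \<le> 1 \<Longrightarrow> \<bar>v (x + h) - v x\<bar> \<le> C * \<bar>h\<bar>"
    and sd: "\<And>x z. \<bar>second_diff v x z\<bar> \<le> C * min (z\<^sup>2) 1"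
    and harmonic: "\<And>x. (\<integral>z. second_diff v x z \<partial>\<mu>) = 0"
    and M: "\<And>x. v x \<le> M"
    and z0: "z0 \<noteq> 0" "\<And>d. d > 0 \<Longrightarrow> emeasure \<mu> (ball z0 d - {0}) > 0"
    and eta: "\<eta> > 0"
  obtains \<kappa> where "\<kappa> > 0" "\<And>x. v x > M - \<kappa> \<Longrightarrow> v (x + z0) > M - \<eta>"
proof (rule ccontr)
  assume "\<not> thesis"
  then have counter: "\<exists>x. v x > M - \<kappa> \<and> v (x + z0) \<le> M - \<eta>" if "\<kappa> > 0" for \<kappa>
    using that \<open>\<not> thesis\<close> \<open>\<And>\<kappa>. 0 < \<kappa> \<Longrightarrow> (\<And>x. M - \<kappa> < v x \<Longrightarrow> M - \<eta> < v (x + z0)) \<Longrightarrow> thesis\<close>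
    by (meson linorder_not_less)
  have C: "C \<ge> 0"
    using lip[of 1 0] by simp
  \<comment> \<open>The radius is at most 1 for the Lipschitz bound, at most |z0| / 2 to keep the
    ball away from 0 and of finite mass, and small enough that v varies by at most \<eta> / 2 around
    x + z0.\<close>
  define d where "d = min (min 1 (\<bar>z0\<bar> / 2)) (\<eta> / (2 * (C + 1)))"
  have d: "d > 0" "d \<le> 1" "d \<le> \<bar>z0\<bar> / 2"
    unfolding d_def using z0 eta C by (simp, linarith+)
  have Cd: "C * d \<le> \<eta> / 2"
  proof -
    have "C * d \<le> (C + 1) * (\<eta> / (2 * (C + 1)))"
      using C d by (intro mult_mono) (auto simp: d_def)
    also have "\<dots> = \<eta> / 2"
      using C by (simp add: divide_simps)
    finally show ?thesis .
  qed
  let ?B = "ball z0 d"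
  have B0: "0 \<notin> ?B"
    using d by (auto simp: dist_real_def)
  then have B: "?B \<in> sets \<mu>" "emeasure \<mu> ?B > 0"
    using z0(2)[OF d(1)] by (auto simp: in_sets_mu_iff)
  have "?B \<subseteq> {z. \<bar>z\<bar> > \<bar>z0\<bar> / 3}"
    using d z0 by (auto simp: dist_real_def)
  then have "emeasure \<mu> ?B \<le> emeasure \<mu> {z. \<bar>z\<bar> > \<bar>z0\<bar> / 3}"
    using z0 by (intro emeasure_mono) (auto simp: in_sets_mu_iff)
  then have Bfin: "emeasure \<mu> ?B < \<infinity>"
    using emeasure_away_from_0[of "\<bar>z0\<bar> / 3"] z0 by (simp add: order_le_less_trans)
  then have mB: "measure \<mu> ?B > 0"
    using B(2) by (simp add: measure_def enn2real_positive_iff)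
  have intB: "integrable \<mu> (\<lambda>z. \<eta> / 2 * indicator ?B z)"
    using B(1) Bfin by auto
  have int_sd: "integrable \<mu> (\<lambda>z. second_diff v x z)" for x
    by (rule integrable_second_diff_mu) (use sd in auto)
  \<comment> \<open>A majorant independent of x: the counterexample x changes with \<kappa>, and
    dominated convergence needs a bound that does not.\<close>
  let ?h = "\<lambda>z. C * min (z\<^sup>2) 1 + \<eta> / 2 * indicator ?B z"
  have h0: "?h z \<ge> 0" for z
    using C eta by (auto simp: indicator_def)
  have int_h: "integrable \<mu> ?h"
    using intB integrable_min by auto
  have int_min: "integrable \<mu> (\<lambda>z. min (?h z) k)" if "k \<ge> 0" for k
    by (rule Bochner_Integration.integrable_bound[OF int_h]) (use int_h h0 that in \<open>auto intro!: AE_I2 simp: min_def\<close>)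
  \<comment> \<open>The left side is a fixed positive number, while the right side tends to 0 with
    \<kappa>. Harmonicity enters by adding the zero integral of the second difference to the left
    side.\<close>
  have key: "\<eta> / 2 * measure \<mu> ?B \<le> (\<integral>z. min (?h z) (2 * \<kappa>) \<partial>\<mu>)" if \<kappa>: "\<kappa> > 0" for \<kappa>
  proof -
    obtain x where x: "v x > M - \<kappa>" "v (x + z0) \<le> M - \<eta>"
      using counter[OF \<kappa>] by blast
    have "\<eta> / 2 * measure \<mu> ?B = (\<integral>z. second_diff v x z + \<eta> / 2 * indicator ?B z \<partial>\<mu>)"
      using int_sd intB harmonic B(1) by simp
    also have "\<dots> \<le> (\<integral>z. min (?h z) (2 * \<kappa>) \<partial>\<mu>)"
    proof (rule integral_mono)
      fix z
      have 1: "second_diff v x z + \<eta> / 2 * indicator ?B z \<le> ?h z"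
        using sd[of x z] by simp
      have 2: "second_diff v x z + \<eta> / 2 * indicator ?B z \<le> 2 * \<kappa>"
      proof (cases "z \<in> ?B")
        case True
        then have zd: "\<bar>z - z0\<bar> \<le> d"
          by (simp add: dist_real_def abs_minus_commute)
        have "\<bar>v ((x + z0) + (z - z0)) - v (x + z0)\<bar> \<le> C * \<bar>z - z0\<bar>"
          using zd d by (intro lip) auto
        also have "\<dots> \<le> \<eta> / 2"
          using mult_left_mono[OF zd C] Cd by simp
        finally have "\<bar>v (x + z) - v (x + z0)\<bar> \<le> \<eta> / 2"
          by simp
        then have "v (x + z) \<le> v (x + z0) + \<eta> / 2"
          by linarith
        then show ?thesis
          using x M[of "x - z"] True by (simp add: second_diff_def)
      next
        case False
        then show ?thesis
          using x M[of "x - z"] M[of "x + z"] by (simp add: second_diff_def)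
      qed
      show "second_diff v x z + \<eta> / 2 * indicator ?B z \<le> min (?h z) (2 * \<kappa>)"
        using 1 2 by simp
    qed (use int_sd intB int_min \<kappa> in auto)
    finally show ?thesis .
  qed
  have "(\<lambda>n. \<integral>z. min (?h z) (2 * (1 / real (Suc n))) \<partial>\<mu>) \<longlonglongrightarrow> (\<integral>z. 0 \<partial>\<mu>)"
  proof (rule integral_dominated_convergence[OF _ _ int_h])
    show "AE z in \<mu>. (\<lambda>n. min (?h z) (2 * (1 / real (Suc n)))) \<longlonglongrightarrow> 0"
    proof (rule AE_I2)
      fix z
      have "(\<lambda>n. min (?h z) (2 * (1 / real (Suc n)))) \<longlonglongrightarrow> min (?h z) (2 * 0)"
        by (intro tendsto_intros LIMSEQ_Suc[OF lim_1_over_n])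
      then show "(\<lambda>n. min (?h z) (2 * (1 / real (Suc n)))) \<longlonglongrightarrow> 0"
        using h0[of z] by (simp add: min_absorb2)
    qed
    show "AE z in \<mu>. norm (min (?h z) (2 * (1 / real (Suc n)))) \<le> ?h z" for n
    proof (rule AE_I2)
      fix z
      show "norm (min (?h z) (2 * (1 / real (Suc n)))) \<le> ?h z"
        using h0[of z] by (auto simp: min_def)
    qed
    show "(\<lambda>z. min (?h z) (2 * (1 / real (Suc n)))) \<in> borel_measurable \<mu>" for n
      using int_min[of "2 * (1 / real (Suc n))"] by auto
  qed simp
  then have "\<eta> / 2 * measure \<mu> ?B \<le> 0"
    unfolding Bochner_Integration.integral_zero
    by (rule Lim_bounded2[where N = 0]) (intro allI impI key, simp)
  then show False
    using eta mB by (simp add: mult_le_0_iff)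
qed

text \<open>If the increment \<open>v x = f (x + z0) - f x\<close> had a positive supremum \<open>M\<close>, then by the strong
  maximum principle it would exceed \<open>M / 2\<close> at arbitrarily many consecutive points \<open>x + i z0\<close>,
  and \<open>f\<close> would be unbounded.\<close>

lemma harmonic_increment_nonpos:
  fixes f :: "real \<Rightarrow> real"
  assumes [measurable]: "f \<in> borel_measurable borel"
    and bnd: "\<And>x. \<bar>f x\<bar> \<le> C"
    and lip: "\<And>x h. \<bar>h\<bar> \<le> 1 \<Longrightarrow> \<bar>f (x + h) - f x\<bar> \<le> C * \<bar>h\<bar>"
    and sd: "\<And>x z. \<bar>second_diff f x z\<bar> \<le> C * min (z\<^sup>2) 1"
    and harmonic: "\<And>x. (\<integral>z. second_diff f x z \<partial>\<mu>) = 0"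
    and z0: "z0 \<noteq> 0" "\<And>d. d > 0 \<Longrightarrow> emeasure \<mu> (ball z0 d - {0}) > 0"
  shows "f (x + z0) \<le> f x"
proof (rule ccontr)
  assume neg: "\<not> f (x + z0) \<le> f x"
  define v where "v x = f (x + z0) - f x" for x
  define M where "M = (SUP x. v x)"
  have v_bnd: "\<bar>v x\<bar> \<le> 2 * C" for x
    using bnd[of x] bnd[of "x + z0"] by (simp add: v_def)
  have bdd: "bdd_above (range v)"
    by (rule bdd_aboveI[of _ "2 * C"]) (use v_bnd in \<open>auto simp: abs_le_iff\<close>)
  have M: "v x \<le> M" for x
    unfolding M_def by (rule cSUP_upper[OF _ bdd]) simp
  have M0: "M > 0"
    using neg M[of x] by (simp add: v_def)
  have [measurable]: "v \<in> borel_measurable borel"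
    unfolding v_def [abs_def] by measurable
  have v_lip: "\<bar>v (x + h) - v x\<bar> \<le> (2 * C) * \<bar>h\<bar>" if "\<bar>h\<bar> \<le> 1" for x h
    using lip[OF that, of x] lip[OF that, of "x + z0"] by (simp add: v_def algebra_simps)
  have v_eq: "second_diff v x z = second_diff f (x + z0) z - second_diff f x z" for x z
    by (simp add: second_diff_def v_def algebra_simps)
  have v_sd: "\<bar>second_diff v x z\<bar> \<le> (2 * C) * min (z\<^sup>2) 1" for x z
    using sd[of x z] sd[of "x + z0" z] by (simp add: v_eq)
  have "integrable \<mu> (second_diff f x)" for x
    by (rule integrable_second_diff_mu) (use sd in auto)
  then have v_harmonic: "(\<integral>z. second_diff v x z \<partial>\<mu>) = 0" for x
    using harmonic by (simp add: v_eq)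
  \<comment> \<open>Thresholds are chosen backwards: k' brings x + z0 within the threshold of the
    induction hypothesis, and M / 2 takes care of i = 0.\<close>
  have iter: "\<exists>\<kappa>>0. \<forall>x. v x > M - \<kappa> \<longrightarrow> (\<forall>i\<le>N. v (x + real i * z0) > M / 2)" for N
  proof (induction N)
    case 0
    then show ?case
      using M0 by (intro exI[of _ "M / 2"]) auto
  next
    case (Suc N)
    then obtain k where k: "k > 0" "\<And>x i. v x > M - k \<Longrightarrow> i \<le> N \<Longrightarrow> v (x + real i * z0) > M / 2"
      by blast
    obtain k' where k': "k' > 0" "\<And>x. v x > M - k' \<Longrightarrow> v (x + z0) > M - k"
      using max_principle_step[of v "2 * C" M z0 k] v_lip v_sd v_harmonic M z0 k(1) by auto
    have "v (x + real i * z0) > M / 2" if x: "v x > M - min k' (M / 2)" and i: "i \<le> Suc N" for x i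
    proof (cases i)
      case 0
      then show ?thesis
        using x by auto
    next
      case (Suc j)
      then show ?thesis
        using k(2)[OF k'(2), of x j] x i by (auto simp: algebra_simps)
    qed
    then show ?case
      using k'(1) M0 by (intro exI[of _ "min k' (M / 2)"]) auto
  qed
  \<comment> \<open>N increments above M / 2 telescope to a difference of two values of f, at most 2
    C; this choice gives N M / 2 > 2 C.\<close>
  obtain N :: nat where N: "4 * C / M < real N"
    using reals_Archimedean2 by blast
  obtain k where k: "k > 0" "\<And>x i. v x > M - k \<Longrightarrow> i \<le> N \<Longrightarrow> v (x + real i * z0) > M / 2"
    using iter[of N] by blast
  obtain y where y: "v y > M - k"
    using less_cSUP_iff[OF _ bdd, of "M - k"] k(1) by (auto simp: M_def)
  have "real N * (M / 2) \<le> (\<Sum>i<N. v (y + real i * z0))"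
    using sum_mono[of "{..<N}" "\<lambda>_. M / 2" "\<lambda>i. v (y + real i * z0)"] k(2)[OF y] by (force intro: less_imp_le)
  also have "\<dots> = (\<Sum>i<N. f (y + real (Suc i) * z0) - f (y + real i * z0))"
    by (simp add: v_def algebra_simps)
  also have "\<dots> = f (y + real N * z0) - f y"
    using sum_lessThan_telescope[of "\<lambda>i. f (y + real i * z0)" N] by simp
  also have "\<dots> \<le> 2 * C"
    using bnd[of y] bnd[of "y + real N * z0"] by linarith
  finally show False
    using N M0 by (simp add: field_simps)
qed

text \<open>The hypotheses are invariant under f \<mapsto> -f, so the increment is neither positive
  nor negative.\<close>

lemma harmonic_periodic:
  fixes f :: "real \<Rightarrow> real"
  assumes [measurable]: "f \<in> borel_measurable borel"
    and bnd: "\<And>x. \<bar>f x\<bar> \<le> C"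
    and lip: "\<And>x h. \<bar>h\<bar> \<le> 1 \<Longrightarrow> \<bar>f (x + h) - f x\<bar> \<le> C * \<bar>h\<bar>"
    and sd: "\<And>x z. \<bar>second_diff f x z\<bar> \<le> C * min (z\<^sup>2) 1"
    and harmonic: "\<And>x. (\<integral>z. second_diff f x z \<partial>\<mu>) = 0"
    and z0: "z0 \<noteq> 0" "\<And>d. d > 0 \<Longrightarrow> emeasure \<mu> (ball z0 d - {0}) > 0"
  shows "f (x + z0) = f x"
proof (rule antisym)
  show "f (x + z0) \<le> f x"
    by (rule harmonic_increment_nonpos[of f C]) (use assms in auto)
  have minus: "second_diff (\<lambda>x. - f x) x z = - second_diff f x z" for x z
    by (simp add: second_diff_def)
  have "- f (x + z0) \<le> - f x"
  proof (rule harmonic_increment_nonpos[of "\<lambda>x. - f x" C])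
    show "\<bar>- f (x + h) - - f x\<bar> \<le> C * \<bar>h\<bar>" if "\<bar>h\<bar> \<le> 1" for x h
      using lip[OF that, of x] by (simp add: abs_minus_commute)
  qed (use assms in \<open>auto simp: minus\<close>)
  then show "f x \<le> f (x + z0)"
    by simp
qed

text \<open>The complement of the support is null: Lindelof's theorem reduces the cover by null
  balls to a countable one. The balls are punctured because sets containing 0 are not in
  \<open>sets \<mu>\<close>.\<close>

lemma null_set_if_locally_null:
  assumes A: "A \<in> sets borel" "0 \<notin> A"
    and loc: "\<And>z. z \<in> A \<Longrightarrow> \<exists>d>0. emeasure \<mu> (ball z d - {0}) = 0"
  shows "A \<in> null_sets \<mu>"
proof -
  define F where "F = {ball z d | z d. emeasure \<mu> (ball z d - {0}) = 0}"
  obtain F' where F': "F' \<subseteq> F" "countable F'" "\<Union>F' = \<Union>F"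
    by (rule Lindelof[of F]) (auto simp: F_def)
  have "(\<Union>S\<in>F'. S - {0}) \<in> null_sets \<mu>"
    using F' by (intro null_sets_UN') (auto simp: F_def in_sets_mu_iff null_sets_def)
  moreover have "A \<subseteq> \<Union>F"
  proof
    fix z assume "z \<in> A"
    then obtain d where "d > 0" "emeasure \<mu> (ball z d - {0}) = 0"
      using loc by blast
    then show "z \<in> \<Union>F"
      by (auto simp: F_def intro!: exI[of _ "ball z d"])
  qed
  then have "A \<subseteq> (\<Union>S\<in>F'. S - {0})"
    using A(2) F'(3) by blast
  ultimately show ?thesis
    using A by (auto intro: null_sets_subset simp: in_sets_mu_iff)
qed

lemma concentrated_on_lattice:
  assumes v[measurable]: "v \<in> borel_measurable borel" and K: "\<And>x. \<bar>v x\<bar> \<le> K"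
    and nonconst: "\<And>c. \<not> (AE x in lborel. v x = c)"
    and harmonic: "\<And>\<psi>. \<psi> \<in> test_functions \<Longrightarrow> (\<integral>z. (\<integral>x. v x * second_diff \<psi> x z \<partial>lborel) \<partial>\<mu>) = 0"
  obtains g where "g > 0" "- range (\<lambda>k::int. of_int k * g) \<in> null_sets \<mu>"
proof -
  define P where "P = {p. \<forall>\<psi>\<in>test_functions. \<forall>t. correlation v \<psi> (t + p) = correlation v \<psi> t}"
  have supp: "z \<in> P" if z: "z \<noteq> 0" "\<And>d. d > 0 \<Longrightarrow> emeasure \<mu> (ball z d - {0}) > 0" for z
    unfolding P_def
  proof (intro CollectI ballI allI)
    fix \<psi> t assume \<psi>: "\<psi> \<in> test_functions"
    obtain C where C: "\<And>t. \<bar>correlation v \<psi> t\<bar> \<le> C"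
      "\<And>t h. \<bar>h\<bar> \<le> 1 \<Longrightarrow> \<bar>correlation v \<psi> (t + h) - correlation v \<psi> t\<bar> \<le> C * \<bar>h\<bar>"
      "\<And>t z. \<bar>second_diff (correlation v \<psi>) t z\<bar> \<le> C * min (z\<^sup>2) 1"
      using correlation_bounds[OF v K \<psi>] by metis
    \<comment> \<open>Testing with \<psi> translated by t is the equation at the point t.\<close>
    have "(\<integral>z. second_diff (correlation v \<psi>) t z \<partial>\<mu>) = 0" for t
      unfolding correlation_second_diff[OF v K \<psi>] by (intro harmonic test_function_translate' \<psi>)
    moreover have "correlation v \<psi> \<in> borel_measurable borel"
    proof -
      note [measurable] = borel_measurable_test_function[OF \<psi>]
      have "(\<lambda>t. \<integral>x. v x * \<psi> (x - t) \<partial>lborel) \<in> borel_measurable borel"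
        by measurable
      then show ?thesis
        by (simp add: correlation_def [abs_def])
    qed
    ultimately show "correlation v \<psi> (t + z) = correlation v \<psi> t"
      using harmonic_periodic[of "correlation v \<psi>" C z t] C z by blast
  qed
  have "\<exists>e>0. \<forall>p\<in>P. 0 < p \<longrightarrow> e \<le> p"
  proof (rule ccontr)
    assume "\<not> ?thesis"
    then have small: "\<exists>p\<in>P. 0 < p \<and> p < e" if "e > 0" for e
      using that by (meson linorder_not_le)
    have "correlation v \<psi> s = correlation v \<psi> t" if \<psi>: "\<psi> \<in> test_functions" for \<psi> s t
    proof -
      obtain C where "\<And>t h. \<bar>h\<bar> \<le> 1 \<Longrightarrow> \<bar>correlation v \<psi> (t + h) - correlation v \<psi> t\<bar> \<le> C * \<bar>h\<bar>"
        using correlation_bounds[OF v K \<psi>] by metis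
      then show ?thesis
        by (rule constant_if_small_periods) (use small \<psi> in \<open>auto simp: P_def\<close>, blast)
    qed
    then show False
      using AE_const_if_correlations_const[OF v K] nonconst by metis
  qed
  then obtain e where e: "e > 0" "\<And>p. p \<in> P \<Longrightarrow> 0 < p \<Longrightarrow> e \<le> p"
    by blast
  have diff: "p - q \<in> P" if "p \<in> P" "q \<in> P" for p q
  proof -
    have "correlation v \<psi> (t + (p - q)) = correlation v \<psi> t" if \<psi>: "\<psi> \<in> test_functions" for \<psi> t
    proof -
      have "correlation v \<psi> (s + r) = correlation v \<psi> s" if "r \<in> P" for s r
        using that \<psi> by (simp add: P_def)
      from this[OF \<open>p \<in> P\<close>, of "t - q"] this[OF \<open>q \<in> P\<close>, of "t - q"] show ?thesis
        by (simp add: algebra_simps)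
    qed
    then show ?thesis
      by (simp add: P_def)
  qed
  obtain g where g: "g > 0" "P \<subseteq> range (\<lambda>k::int. of_int k * g)"
    by (rule discrete_additive_subgroup[of P e]) (use e diff in \<open>auto simp: P_def\<close>)
  have "- range (\<lambda>k::int. of_int k * g) \<in> null_sets \<mu>"
  proof (rule null_set_if_locally_null)
    have "range (\<lambda>k::int. of_int k * g) \<in> sets borel"
      by (rule sets.countable) auto
    then show "- range (\<lambda>k::int. of_int k * g) \<in> sets borel"
      by (rule borel_comp)
    have "0 \<in> range (\<lambda>k::int. of_int k * g)"
      by (rule image_eqI[of _ _ 0]) auto
    then show zero: "0 \<notin> - range (\<lambda>k::int. of_int k * g)"
      by simp
    fix z assume z: "z \<in> - range (\<lambda>k::int. of_int k * g)"
    then have "z \<noteq> 0" "z \<notin> P"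
      using zero g by auto
    then show "\<exists>d>0. emeasure \<mu> (ball z d - {0}) = 0"
      using supp[of z] by (metis not_gr_zero)
  qed
  then show ?thesis
    using that g(1) by blast
qed

end

section \<open>Measures concentrated on a lattice\<close>

lemma lebesgue_measurable_translate:
  assumes "u \<in> borel_measurable lebesgue"
  shows "(\<lambda>x. u (x + c :: real)) \<in> borel_measurable lebesgue"
proof -
  have "(\<lambda>x. c + x) \<in> lebesgue \<rightarrow>\<^sub>M lebesgue"
    using lebesgue_affine_measurable[of "\<lambda>_::real. 1" c] by simp
  from measurable_compose[OF this assms] show ?thesis
    by (simp add: add.commute)
qed

lemma diff_term_eq: "diff_term g \<omega> u n x = \<omega> n * second_diff u x (real n * g)"
  by (simp add: diff_term_def second_diff_def)

lemma borel_measurable_diff_term: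
  assumes "u \<in> Linfty"
  shows "diff_term g \<omega> u n \<in> borel_measurable lebesgue"
proof -
  have [measurable]: "u \<in> borel_measurable lebesgue"
    using assms by (simp add: Linfty_iff)
  have [measurable]: "(\<lambda>x. u (x + c)) \<in> borel_measurable lebesgue" for c
    by (rule lebesgue_measurable_translate) simp
  from this[of "real n * g"] this[of "- (real n * g)"]
  have [measurable]: "(\<lambda>x. u (x + real n * g)) \<in> borel_measurable lebesgue"
    "(\<lambda>x. u (x - real n * g)) \<in> borel_measurable lebesgue"
    by simp_all
  show ?thesis
    unfolding diff_term_def [abs_def] by measurable
qed

lemma AE_diff_term_le:
  assumes "AE x in lebesgue. \<bar>u x\<bar> \<le> K" "\<omega> n \<ge> 0"
  shows "AE x in lebesgue. \<bar>diff_term g \<omega> u n x\<bar> \<le> \<omega> n * (4 * K)"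
proof -
  have u: "AE x in lborel. \<bar>u x\<bar> \<le> K"
    using assms(1) by (simp only: AE_completion_iff)
  have "AE x in lborel. \<bar>diff_term g \<omega> u n x\<bar> \<le> \<omega> n * (4 * K)"
    using u AE_lborel_translate[OF u, of "real n * g"] AE_lborel_translate[OF u, of "- (real n * g)"]
  proof eventually_elim
    fix x assume "\<bar>u x\<bar> \<le> K" "\<bar>u (x + real n * g)\<bar> \<le> K" "\<bar>u (x + - (real n * g))\<bar> \<le> K"
    then have "\<bar>second_diff u x (real n * g)\<bar> \<le> 4 * K"
      by (simp add: second_diff_def)
    then show "\<bar>diff_term g \<omega> u n x\<bar> \<le> \<omega> n * (4 * K)"
      using assms(2) by (simp add: diff_term_eq abs_mult mult_left_mono)
  qed
  then show ?thesis
    by (rule AE_completion)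
qed

text \<open>Discrete integration by parts: translation invariance moves the shifts onto \<psi>, and
  the second difference is symmetric in the sign of the shift.\<close>

lemma distr_of_diff_term:
  assumes u: "u \<in> Linfty"
    and v[measurable]: "v \<in> borel_measurable borel" and K: "\<And>x. \<bar>v x\<bar> \<le> K"
    and uv: "AE x in lborel. u x = v x"
    and \<psi>: "\<psi> \<in> test_functions"
  shows "distr_of (diff_term g \<omega> u n) \<psi> = \<omega> n * (\<integral>x. v x * second_diff \<psi> x (real n * g) \<partial>lborel)"
proof -
  note [measurable] = borel_measurable_test_function[OF \<psi>]
  let ?c = "real n * g"
  have "AE x in lborel. diff_term g \<omega> u n x * \<psi> x = \<omega> n * (second_diff v x ?c * \<psi> x)"
    using uv AE_lborel_translate[OF uv, of ?c] AE_lborel_translate[OF uv, of "- ?c"]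
    by eventually_elim (simp add: diff_term_eq second_diff_def)
  then have eq: "AE x in lebesgue. diff_term g \<omega> u n x * \<psi> x = \<omega> n * (second_diff v x ?c * \<psi> x)"
    by (rule AE_completion)
  have meas: "(\<lambda>x. \<omega> n * (second_diff v x ?c * \<psi> x)) \<in> borel_measurable lborel"
    unfolding second_diff_def by measurable
  have "\<psi> \<in> borel_measurable lebesgue"
    by (rule measurable_completion) simp
  then have "distr_of (diff_term g \<omega> u n) \<psi> = (\<integral>x. \<omega> n * (second_diff v x ?c * \<psi> x) \<partial>lebesgue)"
    unfolding distr_of_def
    by (intro integral_cong_AE[OF borel_measurable_times[OF borel_measurable_diff_term[OF u]]]
        measurable_completion[OF meas] eq)
  also have "\<dots> = (\<integral>x. \<omega> n * (second_diff v x ?c * \<psi> x) \<partial>lborel)"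
    by (rule integral_completion[OF meas])
  also have "\<dots> = \<omega> n * (\<integral>x. second_diff v x ?c * \<psi> x \<partial>lborel)"
    by simp
  also have "(\<integral>x. second_diff v x ?c * \<psi> x \<partial>lborel) = (\<integral>x. v x * second_diff \<psi> x ?c \<partial>lborel)"
  proof -
    have int: "integrable lborel (\<lambda>x. v x * \<psi> (x + s))" for s
      by (intro integrable_bounded_mult[OF v K] integrable_test_function test_function_translate \<psi>)
    have tr: "(\<integral>x. v (x + s) * \<psi> x \<partial>lborel) = (\<integral>x. v x * \<psi> (x + - s) \<partial>lborel)" for s
      using lborel_integral_translate[of "\<lambda>x. v x * \<psi> (x + - s)" s] by simp
    have int': "integrable lborel (\<lambda>x. v (x + s) * \<psi> x)" for s
      using lborel_integrable_translate_iff[of "\<lambda>x. v x * \<psi> (x + - s)" s] int[of "- s"] by simp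
    have "(\<integral>x. second_diff v x ?c * \<psi> x \<partial>lborel)
        = (\<integral>x. v (x + ?c) * \<psi> x + v (x + - ?c) * \<psi> x - 2 * (v (x + 0) * \<psi> x) \<partial>lborel)"
      by (simp add: second_diff_def algebra_simps)
    also have "\<dots> = (\<integral>x. v x * \<psi> (x + ?c) + v x * \<psi> (x + - ?c) - 2 * (v x * \<psi> (x + 0)) \<partial>lborel)"
      using tr[of ?c] tr[of "- ?c"] int[of ?c] int[of "- ?c"] int[of 0] int'[of ?c] int'[of "- ?c"] int'[of 0] by simp
    also have "\<dots> = (\<integral>x. v x * second_diff \<psi> x ?c \<partial>lborel)"
      by (simp add: second_diff_def algebra_simps)
    finally show ?thesis .
  qed
  finally show ?thesis .
qed

lemma Linfty_pairing:
  assumes f: "f \<in> Linfty" and \<psi>: "\<psi> \<in> test_functions"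
  shows "integrable lebesgue (\<lambda>x. f x * \<psi> x)"
    and "\<bar>distr_of f \<psi>\<bar> \<le> Linfty_norm f * (\<integral>x. \<bar>\<psi> x\<bar> \<partial>lebesgue)"
proof -
  note [measurable] = borel_measurable_test_function[OF \<psi>]
  have \<psi>': "integrable lebesgue \<psi>"
    using integrable_test_function[OF \<psi>] by (subst integrable_completion) auto
  have int: "integrable lebesgue (\<lambda>x. Linfty_norm f * \<bar>\<psi> x\<bar>)"
    using \<psi>' by auto
  have le: "AE x in lebesgue. \<bar>f x * \<psi> x\<bar> \<le> Linfty_norm f * \<bar>\<psi> x\<bar>"
    using AE_le_Linfty_norm[OF f] by eventually_elim (simp add: abs_mult mult_right_mono)
  show 1: "integrable lebesgue (\<lambda>x. f x * \<psi> x)"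
  proof (rule Bochner_Integration.integrable_bound[OF int])
    show "(\<lambda>x. f x * \<psi> x) \<in> borel_measurable lebesgue"
      using f borel_measurable_integrable[OF \<psi>'] by (intro borel_measurable_times) (auto simp: Linfty_iff)
    show "AE x in lebesgue. norm (f x * \<psi> x) \<le> norm (Linfty_norm f * \<bar>\<psi> x\<bar>)"
      using le by eventually_elim (simp add: Linfty_norm_nonneg abs_mult)
  qed
  have "\<bar>distr_of f \<psi>\<bar> \<le> (\<integral>x. \<bar>f x * \<psi> x\<bar> \<partial>lebesgue)"
    unfolding distr_of_def by (rule integral_abs_bound)
  also have "\<dots> \<le> (\<integral>x. Linfty_norm f * \<bar>\<psi> x\<bar> \<partial>lebesgue)"
    using 1 int le by (intro integral_mono_AE) auto
  finally show "\<bar>distr_of f \<psi>\<bar> \<le> Linfty_norm f * (\<integral>x. \<bar>\<psi> x\<bar> \<partial>lebesgue)"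
    by simp
qed

lemma Linfty_diff:
  assumes "f \<in> Linfty" "g \<in> Linfty"
  shows "(\<lambda>x. f x - g x) \<in> Linfty"
proof -
  obtain K L where K: "K \<ge> 0" "AE x in lebesgue. \<bar>f x\<bar> \<le> K" and L: "L \<ge> 0" "AE x in lebesgue. \<bar>g x\<bar> \<le> L"
    using assms by (auto simp: Linfty_iff)
  have "AE x in lebesgue. \<bar>f x - g x\<bar> \<le> K + L"
    using K(2) L(2) by eventually_elim linarith
  then show ?thesis
    using K L assms by (auto simp: Linfty_iff intro!: exI[of _ "K + L"])
qed

lemma Linfty_sum:
  assumes "\<And>i. i \<in> I \<Longrightarrow> f i \<in> Linfty"
  shows "(\<lambda>x. \<Sum>i\<in>I. f i x) \<in> Linfty"
  using assms
proof (induction I rule: infinite_finite_induct)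
  case (insert i I)
  have "(\<lambda>x. f i x - (0 - (\<Sum>i\<in>I. f i x))) \<in> Linfty"
    using insert by (intro Linfty_diff) (auto simp: Linfty_iff intro!: exI[of _ 0])
  then show ?case
    using insert by simp
qed (auto simp: Linfty_iff intro!: exI[of _ 0])

lemma distr_of_sums:
  assumes d: "\<And>n. d n \<in> Linfty" and v: "v \<in> Linfty"
    and lim: "(\<lambda>N. Linfty_norm (\<lambda>x. v x - (\<Sum>n<N. d n x))) \<longlonglongrightarrow> 0"
    and \<psi>: "\<psi> \<in> test_functions"
  shows "(\<lambda>n. distr_of (d n) \<psi>) sums distr_of v \<psi>"
proof -
  let ?I = "\<integral>x. \<bar>\<psi> x\<bar> \<partial>lebesgue"
  have "(\<lambda>N. distr_of v \<psi> - (\<Sum>n<N. distr_of (d n) \<psi>)) \<longlonglongrightarrow> 0"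
  proof (rule Lim_null_comparison)
    have "norm (distr_of v \<psi> - (\<Sum>n<N. distr_of (d n) \<psi>))
        \<le> Linfty_norm (\<lambda>x. v x - (\<Sum>n<N. d n x)) * ?I" for N
    proof -
      have "distr_of v \<psi> - (\<Sum>n<N. distr_of (d n) \<psi>) = distr_of (\<lambda>x. v x - (\<Sum>n<N. d n x)) \<psi>"
        using Linfty_pairing(1)[OF v \<psi>] Linfty_pairing(1)[OF d \<psi>]
        by (simp add: distr_of_def left_diff_distrib sum_distrib_right)
      then show ?thesis
        using Linfty_pairing(2)[OF Linfty_diff[OF v Linfty_sum[of "{..<N}" d]] \<psi>] d by simp
    qed
    then show "\<forall>\<^sub>F N in sequentially. norm (distr_of v \<psi> - (\<Sum>n<N. distr_of (d n) \<psi>))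
        \<le> Linfty_norm (\<lambda>x. v x - (\<Sum>n<N. d n x)) * ?I"
      by simp
    show "(\<lambda>N. Linfty_norm (\<lambda>x. v x - (\<Sum>n<N. d n x)) * ?I) \<longlonglongrightarrow> 0"
      by (rule tendsto_mult_left_zero[OF lim])
  qed
  from tendsto_diff[OF tendsto_const[of "distr_of v \<psi>"] this] show ?thesis
    by (simp add: sums_def)
qed

text \<open>Weierstrass test with majorant 4 K \<omega>; the tails of the majorant bound the
  remainders in norm.\<close>

lemma diff_term_normally_convergent:
  assumes u: "u \<in> Linfty" and \<omega>: "\<And>n. n \<ge> 1 \<Longrightarrow> \<omega> n \<ge> 0" and sum: "summable (\<lambda>n. \<omega> (Suc n))"
  shows "diff_term g \<omega> u (Suc n) \<in> Linfty"
    and "summable (\<lambda>n. Linfty_norm (diff_term g \<omega> u (Suc n)))"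
    and "\<exists>v\<in>Linfty. (\<lambda>N. Linfty_norm (\<lambda>x. v x - (\<Sum>n<N. diff_term g \<omega> u (Suc n) x))) \<longlonglongrightarrow> 0"
proof -
  define d where "d n = diff_term g \<omega> u (Suc n)" for n
  obtain K where K: "K \<ge> 0" "AE x in lebesgue. \<bar>u x\<bar> \<le> K"
    using u by (auto simp: Linfty_iff)
  define a where "a n = \<omega> (Suc n) * (4 * K)" for n
  have a: "a n \<ge> 0" for n
    using K \<omega> by (simp add: a_def)
  have sum_a: "summable a"
    unfolding a_def [abs_def] by (intro summable_mult2 sum)
  have d_meas [measurable]: "d n \<in> borel_measurable lebesgue" for n
    unfolding d_def by (rule borel_measurable_diff_term[OF u])
  have d_le: "AE x in lebesgue. \<bar>d n x\<bar> \<le> a n" for n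
    unfolding d_def a_def by (rule AE_diff_term_le[OF K(2)]) (simp add: \<omega>)
  show d_in: "diff_term g \<omega> u (Suc n) \<in> Linfty" for n
    using d_meas[of n] a[of n] d_le[of n] by (auto simp: Linfty_iff d_def)
  have "summable (\<lambda>n. Linfty_norm (d n))"
    by (rule summable_comparison_test'[OF sum_a])
      (auto simp: Linfty_norm_nonneg intro!: Linfty_norm_le a d_le)
  then show "summable (\<lambda>n. Linfty_norm (diff_term g \<omega> u (Suc n)))"
    by (simp add: d_def)
  \<comment> \<open>Off one null set, common to all n, the series converges absolutely. Elsewhere
    \<open>suminf\<close> may return an unspecified value, but v stays measurable.\<close>
  define v where "v x = (\<Sum>n. d n x)" for x
  have v_meas [measurable]: "v \<in> borel_measurable lebesgue"
    unfolding v_def [abs_def] by measurable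
  define tail where "tail N = (\<Sum>n. a (n + N))" for N
  have tail0: "tail N \<ge> 0" for N
    unfolding tail_def by (intro suminf_nonneg summable_ignore_initial_segment sum_a a)
  have all: "AE x in lebesgue. \<forall>n. \<bar>d n x\<bar> \<le> a n"
    using d_le by (simp add: AE_all_countable)
  have tail: "AE x in lebesgue. \<bar>v x - (\<Sum>n<N. d n x)\<bar> \<le> tail N" for N
    using all
  proof eventually_elim
    fix x assume *: "\<forall>n. \<bar>d n x\<bar> \<le> a n"
    have sum_d: "summable (\<lambda>n. \<bar>d n x\<bar>)"
      by (rule summable_comparison_test'[OF sum_a]) (use * in auto)
    have "v x - (\<Sum>n<N. d n x) = (\<Sum>n. d (n + N) x)"
      unfolding v_def using suminf_minus_initial_segment[OF summable_rabs_cancel[OF sum_d], of N] by simp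
    also have "\<bar>\<dots>\<bar> \<le> (\<Sum>n. \<bar>d (n + N) x\<bar>)"
      by (intro summable_rabs summable_ignore_initial_segment sum_d)
    also have "\<dots> \<le> tail N"
      unfolding tail_def
      by (intro suminf_le summable_ignore_initial_segment sum_d sum_a) (use * in auto)
    finally show "\<bar>v x - (\<Sum>n<N. d n x)\<bar> \<le> tail N" .
  qed
  have v: "v \<in> Linfty"
    using tail[of 0] tail0[of 0] v_meas by (auto simp: Linfty_iff)
  have "(\<lambda>N. Linfty_norm (\<lambda>x. v x - (\<Sum>n<N. d n x))) \<longlonglongrightarrow> 0"
  proof (rule Lim_null_comparison)
    have "Linfty_norm (\<lambda>x. v x - (\<Sum>n<N. d n x)) \<le> tail N" for N
      by (intro Linfty_norm_le tail0 tail) measurable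
    then show "\<forall>\<^sub>F N in sequentially. norm (Linfty_norm (\<lambda>x. v x - (\<Sum>n<N. d n x))) \<le> tail N"
      by (simp add: Linfty_norm_nonneg)
    show "tail \<longlonglongrightarrow> 0"
      unfolding tail_def [abs_def] by (rule suminf_exist_split2[OF sum_a])
  qed
  then show "\<exists>v\<in>Linfty. (\<lambda>N. Linfty_norm (\<lambda>x. v x - (\<Sum>n<N. diff_term g \<omega> u (Suc n) x))) \<longlonglongrightarrow> 0"
    using v by (auto simp: d_def)
qed

text \<open>Norm convergence implies convergence of the pairings, so the norm sum v represents the
  distributional sum; uniqueness of sums does the rest.\<close>

lemma levy_eq_series_distr_iff_Linfty:
  assumes "u \<in> Linfty" "\<And>n. n \<ge> 1 \<Longrightarrow> \<omega> n \<ge> 0" "summable (\<lambda>n. \<omega> (Suc n))"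
  shows "levy_eq_series_distr \<mu> g \<omega> u \<longleftrightarrow> levy_eq_series_Linfty \<mu> g \<omega> u"
proof
  note conv = diff_term_normally_convergent[where g = g, OF assms]
  obtain v where v: "v \<in> Linfty"
    "(\<lambda>N. Linfty_norm (\<lambda>x. v x - (\<Sum>n<N. diff_term g \<omega> u (Suc n) x))) \<longlonglongrightarrow> 0"
    using conv(3) by blast
  assume "levy_eq_series_distr \<mu> g \<omega> u"
  then have "\<forall>\<psi>\<in>test_functions. levy_distr \<mu> u \<psi> = distr_of v \<psi>"
    using distr_of_sums[OF conv(1) v] sums_unique2 unfolding levy_eq_series_distr_def by blast
  then show "levy_eq_series_Linfty \<mu> g \<omega> u"
    using conv v by (auto simp: levy_eq_series_Linfty_def)
next
  assume "levy_eq_series_Linfty \<mu> g \<omega> u"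
  then obtain v where "\<And>n. diff_term g \<omega> u (Suc n) \<in> Linfty" "v \<in> Linfty"
    "(\<lambda>N. Linfty_norm (\<lambda>x. v x - (\<Sum>n<N. diff_term g \<omega> u (Suc n) x))) \<longlonglongrightarrow> 0"
    "\<And>\<psi>. \<psi> \<in> test_functions \<Longrightarrow> levy_distr \<mu> u \<psi> = distr_of v \<psi>"
    unfolding levy_eq_series_Linfty_def by blast
  then show "levy_eq_series_distr \<mu> g \<omega> u"
    using distr_of_sums[of "\<lambda>n. diff_term g \<omega> u (Suc n)" v] by (simp add: levy_eq_series_distr_def)
qed

lemma cosine_nonconstant:
  assumes g: "g > 0"
  shows "(\<lambda>x. cos (2 * pi * x / g)) \<in> Linfty" "nonconstant_ae (\<lambda>x. cos (2 * pi * x / g))"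
    "diff_term g \<omega> (\<lambda>x. cos (2 * pi * x / g)) n = (\<lambda>x. 0)"
proof -
  have "(\<lambda>x. cos (2 * pi * x / g)) \<in> borel_measurable lebesgue"
    by (rule measurable_completion) simp
  then show "(\<lambda>x. cos (2 * pi * x / g)) \<in> Linfty"
    by (auto simp: Linfty_iff intro!: exI[of _ 1])
  show "nonconstant_ae (\<lambda>x. cos (2 * pi * x / g))"
    unfolding nonconstant_ae_def
  proof
    assume "\<exists>c. AE x in lebesgue. cos (2 * pi * x / g) = c"
    then obtain c where c: "AE x in lebesgue. x \<in> {x. cos (2 * pi * x / g) = c}"
      by auto
    \<comment> \<open>A closed set of full measure is the whole line, so the cosine would equal c
      everywhere; its values 1 at 0 and -1 at g / 2 refute this.\<close>
    have "closed {x. cos (2 * pi * x / g) = c}"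
      using g by (intro closed_Collect_eq continuous_intros) auto
    then have "cos (2 * pi * x / g) = c" for x
      using mem_closed_if_AE_lebesgue[OF _ c] by blast
    from this[of 0] this[of "g / 2"] show False
      using g by simp
  qed
  have "cos (2 * pi * (x + real n * g) / g) = cos (2 * pi * x / g)"
    "cos (2 * pi * (x - real n * g) / g) = cos (2 * pi * x / g)" for x
  proof -
    have "2 * pi * (x + real n * g) / g = 2 * pi * x / g + 2 * real n * pi"
      "2 * pi * (x - real n * g) / g = 2 * pi * x / g - 2 * real n * pi"
      using g by (simp_all add: field_simps)
    then show "cos (2 * pi * (x + real n * g) / g) = cos (2 * pi * x / g)"
      "cos (2 * pi * (x - real n * g) / g) = cos (2 * pi * x / g)"
      by (simp_all only: cos_add cos_diff cos_2npi sin_2npi mult_1_right mult_zero_right add_0_right diff_0_right)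
  qed
  then show "diff_term g \<omega> (\<lambda>x. cos (2 * pi * x / g)) n = (\<lambda>x. 0)"
    by (simp add: diff_term_def fun_eq_iff)
qed

section \<open>Integration against a symmetric measure on a lattice\<close>

context symmetric_levy_measure
begin

text \<open>Opposite lattice points carry equal mass and equal values of the even function h;
  grouping them in pairs produces the factor 2 that cancels 1 / 2.\<close>

lemma lattice_integral_sums:
  fixes h :: "real \<Rightarrow> real"
  assumes g: "g > 0" and null: "- range (\<lambda>k::int. of_int k * g) \<in> null_sets \<mu>"
    and even: "\<And>z. h (- z) = h z" and h: "integrable \<mu> h"
  shows "(\<lambda>n. measure \<mu> {real (Suc n) * g} * h (real (Suc n) * g)) sums (1 / 2 * (\<integral>z. h z \<partial>\<mu>))"
proof -
  define A where "A n = {real (Suc n) * g, - (real (Suc n) * g)}" for n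
  have A: "A n \<in> sets \<mu>" for n
    using g by (simp add: A_def in_sets_mu_iff)
  have fin: "emeasure \<mu> {z} < \<infinity>" if "z \<noteq> 0" for z
    using radon that unfolding radon_punctured_def by (metis ComplI compact_sing empty_subsetI insert_subset singletonD)
  have mA: "measure \<mu> (A n) = 2 * measure \<mu> {real (Suc n) * g}" for n
  proof -
    let ?z = "real (Suc n) * g"
    have z: "?z > 0"
      using g by simp
    have "emeasure \<mu> {?z} = emeasure \<mu> {- ?z}"
      using symmetric z unfolding symmetric_measure_def
      by (metis image_empty image_insert in_sets_mu_iff borel_singleton sets.empty_sets singletonD less_irrefl)
    moreover have "measure \<mu> ({?z} \<union> {- ?z}) = measure \<mu> {?z} + measure \<mu> {- ?z}"
      using g fin[of ?z, THEN less_imp_neq] fin[of "- ?z", THEN less_imp_neq]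
      by (intro measure_Union) (auto simp: in_sets_mu_iff)
    moreover have "A n = {?z} \<union> {- ?z}"
      by (auto simp: A_def)
    ultimately show ?thesis
      by (simp add: measure_def)
  qed
  \<comment> \<open>Since \<open>A\<close> is indexed from 0, the point k g lies in the pair with
    index |k| - 1 and in no other; k \<noteq> 0 rules out truncation of the subtraction.\<close>
  have ind: "indicator (A i) (of_int k * g) = (if i = nat \<bar>k\<bar> - 1 then 1 else 0 :: real)" if "k \<noteq> 0" for i k
  proof -
    have "of_int k * g \<in> A i \<longleftrightarrow> \<bar>k\<bar> = int (Suc i)"
    proof -
      have "of_int k * g \<in> A i \<longleftrightarrow> of_int k * g = real (Suc i) * g \<or> of_int k * g = (- real (Suc i)) * g"
        unfolding A_def mult_minus_left by blast
      also have "\<dots> \<longleftrightarrow> of_int k = real (Suc i) \<or> of_int k = - real (Suc i)"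
        using g by (simp only: mult_cancel_right) blast
      also have "\<dots> \<longleftrightarrow> k = int (Suc i) \<or> k = - int (Suc i)"
        by linarith
      finally show ?thesis
        by auto
    qed
    then show ?thesis
      using that by (auto simp: indicator_def)
  qed
  have "(\<lambda>N. \<integral>z. (\<Sum>i<N. indicator (A i) z * h z) \<partial>\<mu>) \<longlonglongrightarrow> (\<integral>z. h z \<partial>\<mu>)"
  proof (rule integral_dominated_convergence)
    have lattice: "AE z in \<mu>. \<exists>k::int. k \<noteq> 0 \<and> z = of_int k * g"
      using AE_not_in[OF null] AE_space
      by eventually_elim (auto simp: space_mu)
    have eq: "(\<Sum>i<N. indicator (A i) (of_int k * g) * h (of_int k * g))
        = (if nat \<bar>k\<bar> - 1 < N then h (of_int k * g) else 0)" if "k \<noteq> 0" for N k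
    proof -
      have "(\<Sum>i<N. indicator (A i) (of_int k * g) * h (of_int k * g))
          = (\<Sum>i<N. if i = nat \<bar>k\<bar> - 1 then h (of_int k * g) else 0)"
        by (rule sum.cong) (auto simp: ind[OF that])
      then show ?thesis
        by simp
    qed
    show "AE z in \<mu>. (\<lambda>N. \<Sum>i<N. indicator (A i) z * h z) \<longlonglongrightarrow> h z"
      using lattice
    proof eventually_elim
      fix z assume "\<exists>k::int. k \<noteq> 0 \<and> z = of_int k * g"
      then obtain k :: int where k: "k \<noteq> 0" "z = of_int k * g"
        by blast
      have "\<forall>\<^sub>F N in sequentially. (\<Sum>i<N. indicator (A i) z * h z) = h z"
        using eventually_gt_at_top[of "nat \<bar>k\<bar> - 1"] by eventually_elim (simp only: k(2) eq[OF k(1)] if_True)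
      then show "(\<lambda>N. \<Sum>i<N. indicator (A i) z * h z) \<longlonglongrightarrow> h z"
        by (rule tendsto_eventually)
    qed
    show "AE z in \<mu>. norm (\<Sum>i<N. indicator (A i) z * h z) \<le> \<bar>h z\<bar>" for N
      using lattice
    proof eventually_elim
      fix z assume "\<exists>k::int. k \<noteq> 0 \<and> z = of_int k * g"
      then obtain k :: int where k: "k \<noteq> 0" "z = of_int k * g"
        by blast
      show "norm (\<Sum>i<N. indicator (A i) z * h z) \<le> \<bar>h z\<bar>"
        unfolding k(2) eq[OF k(1)] by simp
    qed
    show "(\<lambda>z. \<Sum>i<N. indicator (A i) z * h z) \<in> borel_measurable \<mu>" for N
      using h A by (intro borel_measurable_sum borel_measurable_times borel_measurable_indicator) auto
  qed (use h in auto)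
  moreover have "(\<integral>z. (\<Sum>i<N. indicator (A i) z * h z) \<partial>\<mu>)
      = (\<Sum>i<N. 2 * (measure \<mu> {real (Suc i) * g} * h (real (Suc i) * g)))" for N
  proof -
    have "(\<integral>z. indicator (A i) z * h z \<partial>\<mu>) = 2 * (measure \<mu> {real (Suc i) * g} * h (real (Suc i) * g))" for i
    proof -
      have "(\<lambda>z. indicator (A i) z * h z) = (\<lambda>z. h (real (Suc i) * g) * indicator (A i) z)"
        using even[of "real (Suc i) * g"] by (auto simp: A_def indicator_def fun_eq_iff)
      then have "(\<integral>z. indicator (A i) z * h z \<partial>\<mu>) = h (real (Suc i) * g) * measure \<mu> (A i \<inter> space \<mu>)"
        by simp
      also have "A i \<inter> space \<mu> = A i"
        using sets.sets_into_space[OF A] by blast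
      finally show ?thesis
        by (simp add: mA)
    qed
    moreover have "integrable \<mu> (\<lambda>z. indicator (A i) z * h z)" for i
      using integrable_mult_indicator[OF A h, of i] by simp
    ultimately show ?thesis
      by (subst Bochner_Integration.integral_sum) (simp_all only:)
  qed
  ultimately have "(\<lambda>n. 2 * (measure \<mu> {real (Suc n) * g} * h (real (Suc n) * g))) sums (\<integral>z. h z \<partial>\<mu>)"
    unfolding sums_def by (simp only:)
  from sums_mult[OF this, of "1 / 2"] show ?thesis
    by simp
qed

lemma lattice_representation:
  assumes g: "g > 0" and null: "- range (\<lambda>k::int. of_int k * g) \<in> null_sets \<mu>"
  defines "\<omega> \<equiv> \<lambda>n. measure \<mu> {real n * g}"
  shows "summable (\<lambda>n. \<omega> (Suc n))" "\<And>u. u \<in> Linfty \<Longrightarrow> levy_eq_series_distr \<mu> g \<omega> u"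
proof -
  \<comment> \<open>All nonzero lattice points have |z| \<ge> g, hence min(z^2, 1) \<ge> m there,
    and integrability of min(z^2, 1) bounds the sum of the weights.\<close>
  define m where "m = min (g\<^sup>2) 1"
  have m: "m > 0"
    using g by (simp add: m_def)
  have "summable (\<lambda>n. \<omega> (Suc n) * min ((real (Suc n) * g)\<^sup>2) 1)"
    using lattice_integral_sums[OF g null _ integrable_min] unfolding \<omega>_def
    by (rule sums_summable) simp
  then have sum: "summable (\<lambda>n. \<omega> (Suc n) * min ((real (Suc n) * g)\<^sup>2) 1 / m)"
    by (rule summable_divide)
  show "summable (\<lambda>n. \<omega> (Suc n))"
  proof (rule summable_comparison_test'[OF sum])
    fix n
    have "g \<le> real (Suc n) * g"
      using g by simp
    then have "m \<le> min ((real (Suc n) * g)\<^sup>2) 1"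
      using g power_mono[of g "real (Suc n) * g" 2] unfolding m_def by (intro min.mono) auto
    then have "\<omega> (Suc n) * m \<le> \<omega> (Suc n) * min ((real (Suc n) * g)\<^sup>2) 1"
      by (intro mult_left_mono) (auto simp: \<omega>_def)
    then show "norm (\<omega> (Suc n)) \<le> \<omega> (Suc n) * min ((real (Suc n) * g)\<^sup>2) 1 / m"
      using m by (simp add: pos_le_divide_eq \<omega>_def)
  qed
  fix u assume u: "u \<in> Linfty"
  obtain v K where v[measurable]: "v \<in> borel_measurable borel" and K: "K \<ge> 0" "\<And>x. \<bar>v x\<bar> \<le> K"
    and uv: "AE x in lborel. u x = v x"
    using Linfty_borel_representative[OF u] by metis
  show "levy_eq_series_distr \<mu> g \<omega> u"
    unfolding levy_eq_series_distr_def
  proof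
    fix \<psi> assume \<psi>: "\<psi> \<in> test_functions"
    \<comment> \<open>The \<mu>-integral of T gives \<open>levy_distr\<close>, and its values at the
      multiples of g give the pairings of the series terms.\<close>
    define T where "T z = (\<integral>x. v x * second_diff \<psi> x z \<partial>lborel)" for z
    obtain C where C: "C \<ge> 0" "\<And>z. (\<integral>x. \<bar>second_diff \<psi> x z\<bar> \<partial>lborel) \<le> C * min (z\<^sup>2) 1"
      using second_diff_test_bounds[OF \<psi>] by metis
    have T_le: "\<bar>T z\<bar> \<le> K * (C * min (z\<^sup>2) 1)" for z
    proof -
      have "\<bar>T z\<bar> \<le> K * (\<integral>x. \<bar>second_diff \<psi> x z\<bar> \<partial>lborel)"
        unfolding T_def by (intro integrable_bounded_mult[OF v K(2)] integrable_second_diff \<psi>)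
      also have "\<dots> \<le> K * (C * min (z\<^sup>2) 1)"
        using C K by (intro mult_left_mono)
      finally show ?thesis .
    qed
    have T_int: "integrable \<mu> T"
    proof (rule Bochner_Integration.integrable_bound)
      show "integrable \<mu> (\<lambda>z. K * (C * min (z\<^sup>2) 1))"
        using integrable_min by auto
      note [measurable] = borel_measurable_test_function[OF \<psi>]
      have "T \<in> borel_measurable borel"
        unfolding T_def [abs_def] second_diff_def by measurable
      then show "T \<in> borel_measurable \<mu>"
        by (rule measurable_mu)
      show "AE z in \<mu>. norm (T z) \<le> norm (K * (C * min (z\<^sup>2) 1))"
        by (intro AE_I2) (metis T_le abs_ge_self order_trans real_norm_def)
    qed
    have "(\<lambda>n. \<omega> (Suc n) * T (real (Suc n) * g)) sums (1 / 2 * (\<integral>z. T z \<partial>\<mu>))"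
      unfolding \<omega>_def by (rule lattice_integral_sums[OF g null _ T_int]) (simp add: T_def)
    then show "(\<lambda>n. distr_of (diff_term g \<omega> u (Suc n)) \<psi>) sums levy_distr \<mu> u \<psi>"
      by (simp only: distr_of_diff_term[OF u v K(2) uv \<psi>] levy_distr_eq[OF u v K(2) uv \<psi>] T_def)
  qed
qed

lemma lattice_if_Liouville_fails:
  assumes u: "u \<in> Linfty" "nonconstant_ae u" "\<And>\<psi>. \<psi> \<in> test_functions \<Longrightarrow> levy_distr \<mu> u \<psi> = 0"
  obtains g where "g > 0" "- range (\<lambda>k::int. of_int k * g) \<in> null_sets \<mu>"
proof -
  obtain v K where v: "v \<in> borel_measurable borel" and K: "\<And>x. \<bar>v x\<bar> \<le> K"
    and uv: "AE x in lborel. u x = v x"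
    using Linfty_borel_representative[OF u(1)] by metis
  have "\<not> (AE x in lborel. v x = c)" for c
  proof
    assume "AE x in lborel. v x = c"
    with uv have "AE x in lborel. u x = c"
      by eventually_elim simp
    then have "AE x in lebesgue. u x = c"
      by (rule AE_completion)
    then show False
      using u(2) by (auto simp: nonconstant_ae_def)
  qed
  moreover have "(\<integral>z. (\<integral>x. v x * second_diff \<psi> x z \<partial>lborel) \<partial>\<mu>) = 0" if "\<psi> \<in> test_functions" for \<psi>
    using levy_distr_eq[OF u(1) v K uv that] u(3)[OF that] by simp
  ultimately show ?thesis
    using concentrated_on_lattice[OF v K] that by blast
qed

end

theorem proposition4p15:
  fixes \<mu> :: "real measure"
  assumes "radon_punctured \<mu>"
    and "symmetric_measure \<mu>"
    and "levy_integrable \<mu>"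
  shows "((\<exists>u\<in>Linfty. nonconstant_ae u \<and> (\<forall>\<psi>\<in>test_functions. levy_distr \<mu> u \<psi> = 0)) \<longleftrightarrow>
          (\<exists>(g::real) (\<omega>::nat \<Rightarrow> real). g > 0 \<and> (\<forall>n\<ge>1. \<omega> n \<ge> 0) \<and> summable (\<lambda>n. \<omega> (Suc n)) \<and>
             (\<forall>u\<in>Linfty. levy_eq_series_distr \<mu> g \<omega> u)))
       \<and> (\<forall>(g::real) (\<omega>::nat \<Rightarrow> real).
             g > 0 \<and> (\<forall>n\<ge>1. \<omega> n \<ge> 0) \<and> summable (\<lambda>n. \<omega> (Suc n)) \<longrightarrow>
             (\<forall>u\<in>Linfty. levy_eq_series_distr \<mu> g \<omega> u \<longleftrightarrow> levy_eq_series_Linfty \<mu> g \<omega> u))"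
proof (rule conjI, rule iffI)
  interpret symmetric_levy_measure \<mu>
    using assms by unfold_locales
  assume "\<exists>u\<in>Linfty. nonconstant_ae u \<and> (\<forall>\<psi>\<in>test_functions. levy_distr \<mu> u \<psi> = 0)"
  then obtain u where "u \<in> Linfty" "nonconstant_ae u" "\<And>\<psi>. \<psi> \<in> test_functions \<Longrightarrow> levy_distr \<mu> u \<psi> = 0"
    by blast
  then obtain g where g: "g > 0" "- range (\<lambda>k::int. of_int k * g) \<in> null_sets \<mu>"
    by (rule lattice_if_Liouville_fails)
  show "\<exists>(g::real) (\<omega>::nat \<Rightarrow> real). g > 0 \<and> (\<forall>n\<ge>1. \<omega> n \<ge> 0) \<and> summable (\<lambda>n. \<omega> (Suc n)) \<and>
      (\<forall>u\<in>Linfty. levy_eq_series_distr \<mu> g \<omega> u)"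
    using lattice_representation[OF g] g(1)
    by (intro exI[of _ g] exI[of _ "\<lambda>n. measure \<mu> {real n * g}"]) auto
next
  assume "\<exists>(g::real) (\<omega>::nat \<Rightarrow> real). g > 0 \<and> (\<forall>n\<ge>1. \<omega> n \<ge> 0) \<and> summable (\<lambda>n. \<omega> (Suc n)) \<and>
      (\<forall>u\<in>Linfty. levy_eq_series_distr \<mu> g \<omega> u)"
  then obtain g \<omega> where g: "g > 0" and eq: "\<And>u. u \<in> Linfty \<Longrightarrow> levy_eq_series_distr \<mu> g \<omega> u"
    by blast
  \<comment> \<open>With period g, every term of the assumed series vanishes, so the assumed
    identity itself forces \<open>levy_distr\<close> to be 0.\<close>
  let ?u = "\<lambda>x. cos (2 * pi * x / g)"
  have "(\<lambda>n. 0) sums levy_distr \<mu> ?u \<psi>" if "\<psi> \<in> test_functions" for \<psi>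
    using eq[OF cosine_nonconstant(1)[OF g]] that
    by (simp add: levy_eq_series_distr_def cosine_nonconstant(3)[OF g] distr_of_def)
  then show "\<exists>u\<in>Linfty. nonconstant_ae u \<and> (\<forall>\<psi>\<in>test_functions. levy_distr \<mu> u \<psi> = 0)"
    using cosine_nonconstant(1,2)[OF g] sums_unique2[OF _ sums_zero] by blast
next
  show "\<forall>(g::real) (\<omega>::nat \<Rightarrow> real).
      g > 0 \<and> (\<forall>n\<ge>1. \<omega> n \<ge> 0) \<and> summable (\<lambda>n. \<omega> (Suc n)) \<longrightarrow>
      (\<forall>u\<in>Linfty. levy_eq_series_distr \<mu> g \<omega> u \<longleftrightarrow> levy_eq_series_Linfty \<mu> g \<omega> u)"
    by (intro allI impI ballI levy_eq_series_distr_iff_Linfty) auto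
qed

end
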